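(* Suppose that: (B) there is a constant $B<\infty$ such that $\Pr(|X_{n+1}-X_n|\le B)=1$ for all $n\in\mathbb{Z}_+$; (N) $\limsup_{n\to\infty}X_n=+\infty$ a.s.; (V) $\liminf_{x\to\infty}\underline{\mu}_2(x)>0$. Suppose also that \[ \liminf_{x\to\infty}\bigl(2x\underline{\mu}_1(x)-\overline{\mu}_2(x)\bigr)>0 \quad\text{and}\quad \limsup_{x\to\infty}\bigl(x\overline{\mu}_1(x)\bigr)<\infty . \] Then for any $h\in(0,\infty)$ and $k\in\mathbb{Z}_+$, a.s. there exist infinitely many disjoint $(h,k)$ cut intervals. In particular $\Pr(\#\mathcal{C}_s=\infty)=1$. Moreover, if $\mathbb{E}X_0<\infty$ then there is a constant $c>0$ such that $\mathbb{E}\,\#(\mathcal{C}_s\cap[0,x])\ge c\log x$ for all $x$ sufficiently large.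
   Context: $\mathbb{Z}_+=\{0,1,2,\dots\}$ and $\mathbb{R}_+=[0,\infty)$. $X=(X_n;n\in\mathbb{Z}_+)$ is a discrete-time stochastic process (not necessarily Markov) adapted to a filtration $(\mathcal{F}_n;n\in\mathbb{Z}_+)$, taking values in a measurable set $\mathcal{X}\subset\mathbb{R}_+$ with $\inf\mathcal{X}=0$ and $\sup\mathcal{X}=\infty$; $X_0$ may be random. Write $\Delta_n:=X_{n+1}-X_n$. For $k=1,2$, $\underline{\mu}_k,\overline{\mu}_k:\mathcal{X}\to\mathbb{R}$ are measurable functions such that, for all $n\in\mathbb{Z}_+$, $\underline{\mu}_k(X_n)\le\mathbb{E}(\Delta_n^k\mid\mathcal{F}_n)\le\overline{\mu}_k(X_n)$ a.s. Limits as $x\to\infty$ of these functions are along $x\in\mathcal{X}$. $\#A$ is the number of elements of a set $A$; $|I|$ is the Lebesgue measure of $I$. A point $x\in\mathbb{R}_+$ is a strong cutpoint for $X$ if there exists $n_0\in\mathbb{Z}_+$ such that $X_n<x$ for all $n<n_0$, $X_{n_0}=x$, and $X_n>x$ for all $n>n_0$. $\mathcal{C}_s$ is the (random) set of strong cutpoints. For $h>0$ and $k\in\mathbb{Z}_+$, an interval $I\subset\mathbb{R}_+$ is an $(h,k)$ cut interval if $|I|\ge h$, there are at least $k$ points of $X_0,X_1,\dots$ in the interior of $I$, and every point of $X_0,X_1,\dots$ in the interior of $I$ is a strong cutpoint for $X$. *)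

theory Defs
  imports "HOL-Probability.Probability"
begin

text \<open>The notions below are pathwise: \<open>x :: nat \<Rightarrow> real\<close> is one trajectory of the process.\<close>

definition strong_cutpoint :: "(nat \<Rightarrow> real) \<Rightarrow> real \<Rightarrow> bool" where
  "strong_cutpoint x y \<longleftrightarrow>
     y \<ge> 0 \<and> (\<exists>n0. (\<forall>n<n0. x n < y) \<and> x n0 = y \<and> (\<forall>n>n0. x n > y))"

definition strong_cutpoints :: "(nat \<Rightarrow> real) \<Rightarrow> real set" where
  "strong_cutpoints x = {y. strong_cutpoint x y}"

text \<open>The points of the trajectory in the interior of \<open>I\<close> are counted as distinct real numbers.
  Counting time indices instead gives the same notion, since a strong cutpoint is visited exactly
  once. The disjunct \<open>infinite\<close> is needed because \<open>card\<close> is \<open>0\<close> on infinite sets.\<close>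

definition cut_interval :: "real \<Rightarrow> nat \<Rightarrow> (nat \<Rightarrow> real) \<Rightarrow> real set \<Rightarrow> bool" where
  "cut_interval h k x I \<longleftrightarrow>
     is_interval I \<and> I \<subseteq> {0..} \<and>
     emeasure lborel I \<ge> ennreal h \<and>
     (infinite (range x \<inter> interior I) \<or> card (range x \<inter> interior I) \<ge> k) \<and>
     (\<forall>y \<in> range x \<inter> interior I. strong_cutpoint x y)"

text \<open>The filter for limits as \<open>x \<rightarrow> \<infinity>\<close> along \<open>x \<in> S\<close>.\<close>

definition at_top_along :: "real set \<Rightarrow> real filter" where
  "at_top_along S = inf at_top (principal S)"

end

theory Submission
  imports Defs
begin

text \<open>
  The drift conditions make \<open>X\<^sup>-\<^sup>p\<close> a supermartingale far from
  the origin for small \<open>p > 0\<close>, and a submartingale for large \<open>p\<close>. By optional stopping, a process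
  that has just passed a level \<open>y\<close> never returns below it with probability of order \<open>1/y\<close>, from above
  and from below, and it reaches \<open>y' > y\<close> before returning below \<open>y\<close> with probability at most of order
  \<open>y'/(y (y' - y))\<close>. The variance condition allows a fixed number of consecutive upward steps with
  probability bounded below, so with probability of order \<open>1/y\<close> the process crosses \<open>[y, y + L]\<close>
  monotonically and never comes back, which makes \<open>(y, y + L)\<close> a cut interval.

  Let \<open>N\<close> count these events over the levels \<open>y = L, 2L, \<dots>, mL\<close>. Then \<open>E N\<close> is of order \<open>log m\<close>, which
  gives the lower bound on the expectation. The pair probability is \<open>O(1/(i (j - i)))\<close>, so
  \<open>E (N\<^sup>2) = O(log\<^sup>2 m)\<close>, and by the Paley-Zygmund inequality infinitely many of the events occur with
  probability bounded below, uniformly conditionally on every \<open>F n\<close>. An approximation argument in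
  the style of the zero-one law of Levy upgrades this to probability one.
\<close>

subsection \<open>Expansion of negative powers\<close>

text \<open>The process is not Markov, so nothing can be read off from its current state alone.
  Every estimate is therefore stated for an arbitrary \<open>A \<in> sets (F n)\<close> as a
  comparison with \<open>prob A\<close>, with constants that depend neither on \<open>n\<close> nor
  on \<open>A\<close>. Such integrated conditional probabilities can be chained through first
  passages by summing over the passage time, and they are exactly what the zero-one argument
  consumes. The order \<open>1/y\<close> arises because a shift of bounded size changes
  \<open>y powr - p\<close> by a fraction of order \<open>1/y\<close>. Along equally spaced levels
  this produces the harmonic series, hence the logarithm. Cut events at nearby levels are strongly
  dependent: given the one at \<open>i\<close>, the bound for the one at \<open>j\<close> is of
  order \<open>1/(j - i)\<close>, not \<open>1/j\<close>. Independence-type Borel-Cantelli arguments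
  therefore fail, but the double sum of \<open>1/(i (j - i))\<close> exceeds the square of the
  harmonic sum by a constant factor only, and this is all that a second moment argument
  needs.\<close>

lemma powr_neg_taylor:
  fixes p :: real
  assumes "p > 0"
  obtains C where "C \<ge> 0"
    "\<And>u. \<bar>u\<bar> \<le> 1/2 \<Longrightarrow> \<bar>(1 + u) powr - p - (1 - p * u + p * (p + 1) / 2 * u^2)\<bar> \<le> C * \<bar>u\<bar>^3"
proof -
  define diff where "diff m x = (if m = 0 then x powr - p else if m = 1 then - p * x powr (- p - 1)
     else if m = 2 then p * (p + 1) * x powr (- p - 2)
     else - p * (p + 1) * (p + 2) * x powr (- p - 3))" for m :: nat and x :: real
  \<comment> \<open>The third derivative decreases in size, so its value at \<open>1/2\<close>, the
    left end of the range of \<open>1 + u\<close>, bounds it; the factor \<open>1/6\<close> of the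
    remainder is given away.\<close>
  define C where "C = p * (p + 1) * (p + 2) * (1/2) powr (- p - 3)"
  have der: "(diff m has_real_derivative diff (Suc m) t) (at t)" if "m < 3" "t > 0" for m t
  proof -
    consider "m = 0" | "m = 1" | "m = 2" using \<open>m < 3\<close> by linarith
    then show ?thesis
    proof cases
      case 1
      show ?thesis unfolding diff_def 1
        by (auto intro!: derivative_eq_intros simp: \<open>t > 0\<close> less_imp_neq[OF \<open>t > 0\<close>])
    next
      case 2
      show ?thesis unfolding diff_def 2
        by (auto intro!: derivative_eq_intros simp: \<open>t > 0\<close> less_imp_neq[OF \<open>t > 0\<close>] algebra_simps)
    next
      case 3
      show ?thesis unfolding diff_def 3
        by (auto intro!: derivative_eq_intros simp: \<open>t > 0\<close> less_imp_neq[OF \<open>t > 0\<close>] algebra_simps)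
    qed
  qed
  have "\<bar>(1 + u) powr - p - (1 - p * u + p * (p + 1) / 2 * u^2)\<bar> \<le> C * \<bar>u\<bar>^3" if u: "\<bar>u\<bar> \<le> 1/2" for u
  proof (cases "u = 0")
    case False
    have "\<exists>t. (if 1 + u < 1 then 1 + u < t \<and> t < 1 else 1 < t \<and> t < 1 + u) \<and>
        diff 0 (1 + u) = (\<Sum>m<3. (diff m 1 / fact m) * (1 + u - 1)^m) + (diff 3 t / fact 3) * (1 + u - 1)^3"
      by (rule Taylor[of 3 diff "diff 0" "1/2" "3/2"]) (use u False der in auto)
    then obtain t where "if 1 + u < 1 then 1 + u < t \<and> t < 1 else 1 < t \<and> t < 1 + u"
      "diff 0 (1 + u) = (\<Sum>m<3. (diff m 1 / fact m) * (1 + u - 1)^m) + (diff 3 t / fact 3) * (1 + u - 1)^3"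
      by blast
    then have t: "t \<ge> 1/2"
      "diff 0 (1 + u) = (\<Sum>m<3. (diff m 1 / fact m) * u^m) + (diff 3 t / fact 3) * u^3"
      using u by (auto split: if_splits)
    have "(\<Sum>m<3. (diff m 1 / fact m) * u^m) = 1 - p * u + p * (p + 1) / 2 * u^2"
      by (simp add: eval_nat_numeral diff_def)
    then have "\<bar>(1 + u) powr - p - (1 - p * u + p * (p + 1) / 2 * u^2)\<bar> = \<bar>diff 3 t / 6\<bar> * \<bar>u\<bar>^3"
      using t(2) by (simp add: diff_def fact_numeral power_abs abs_mult)
    also have "\<bar>diff 3 t / 6\<bar> \<le> C"
    proof -
      have "t powr (- p - 3) \<le> (1/2) powr (- p - 3)"
        using t assms by (intro powr_mono2') auto
      then have "\<bar>diff 3 t\<bar> \<le> C"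
        using assms unfolding diff_def C_def by (auto simp: abs_mult intro!: mult_left_mono)
      then show ?thesis by simp
    qed
    finally show ?thesis by (simp add: mult_right_mono)
  qed simp
  moreover have "C \<ge> 0" using assms by (simp add: C_def)
  ultimately show thesis using that by blast
qed

subsection \<open>Lyapunov functions\<close>

text \<open>Truncating at \<open>1\<close> keeps the powers bounded, measurable and monotone on the whole line; in
  particular it avoids the junk value \<open>0 powr - p = 0\<close>.\<close>

definition phi :: "real \<Rightarrow> real \<Rightarrow> real" where
  "phi p x = max 1 x powr - p"

lemma borel_measurable_phi [measurable]: "phi p \<in> borel_measurable borel"
  unfolding phi_def by measurable

lemma phi_pos: "phi p x > 0"
  by (simp add: phi_def)

lemma powr_nonpos_le_1: "x \<ge> 1 \<Longrightarrow> q \<le> 0 \<Longrightarrow> x powr q \<le> (1::real)"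
  using powr_mono[of q 0 x] by simp

lemma phi_le_1: "p > 0 \<Longrightarrow> phi p x \<le> 1"
  unfolding phi_def by (rule powr_nonpos_le_1) auto

lemma phi_antimono: "p > 0 \<Longrightarrow> x \<le> y \<Longrightarrow> phi p y \<le> phi p x"
  unfolding phi_def by (rule powr_mono2') auto

lemma phi_eq: "x \<ge> 1 \<Longrightarrow> phi p x = x powr - p"
  by (simp add: phi_def max_def)

text \<open>The factorisation isolates the bracket \<open>- 2 * x * d + (p + 1) * d^2\<close>, whose
  conditional expectation has a sign decided by the drift hypotheses; the remainder is smaller by a
  factor \<open>1/x\<close>. The condition \<open>x \<ge> 2 * B\<close> keeps the relative increment
  within \<open>1/2\<close> and the new position at or above \<open>1\<close>, where the truncation
  in \<open>phi\<close> is inactive.\<close>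

lemma phi_expansion:
  assumes "p > 0" "B \<ge> 1"
  obtains C where "C \<ge> 0"
    "\<And>x d. x \<ge> 2 * B \<Longrightarrow> \<bar>d\<bar> \<le> B \<Longrightarrow>
      \<bar>phi p (x + d) - phi p x - x powr (- p - 2) * (p / 2 * (- 2 * x * d + (p + 1) * d^2))\<bar>
        \<le> x powr (- p - 2) * (C / x)"
proof -
  obtain C where C: "C \<ge> 0"
    "\<And>u. \<bar>u\<bar> \<le> 1/2 \<Longrightarrow> \<bar>(1 + u) powr - p - (1 - p * u + p * (p + 1) / 2 * u^2)\<bar> \<le> C * \<bar>u\<bar>^3"
    using powr_neg_taylor[OF \<open>p > 0\<close>] by metis
  have "\<bar>phi p (x + d) - phi p x - x powr (- p - 2) * (p / 2 * (- 2 * x * d + (p + 1) * d^2))\<bar>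
        \<le> x powr (- p - 2) * (C * B^3 / x)" if x: "x \<ge> 2 * B" and d: "\<bar>d\<bar> \<le> B" for x d
  proof -
    define w where "w = x powr (- p - 2)"
    have x0: "x > 0" using x assms by simp
    have w: "w \<ge> 0" by (simp add: w_def)
    have wx: "x powr - p = w * x^2"
      using x0 powr_add[of x "- p - 2" 2] by (simp add: w_def powr_numeral)
    define u where "u = d / x"
    have du: "d = u * x" using x0 by (simp add: u_def)
    have u: "\<bar>u\<bar> \<le> 1/2" using x d x0 assms by (simp add: u_def abs_divide field_simps)
    have "x + d = x * (1 + u)" using x0 by (simp add: u_def field_simps)
    moreover have "x + d \<ge> 1" using x d assms by linarith
    ultimately have "phi p (x + d) = w * x^2 * (1 + u) powr - p"
      using x0 u wx by (simp add: phi_eq powr_mult)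
    moreover have "phi p x = w * x^2" using x assms wx by (simp add: phi_eq)
    ultimately have "phi p (x + d) - phi p x - w * (p / 2 * (- 2 * x * d + (p + 1) * d^2))
        = w * x^2 * ((1 + u) powr - p - (1 - p * u + p * (p + 1) / 2 * u^2))"
      unfolding du by (simp add: algebra_simps power2_eq_square)
    then have "\<bar>phi p (x + d) - phi p x - w * (p / 2 * (- 2 * x * d + (p + 1) * d^2))\<bar>
        = w * x^2 * \<bar>(1 + u) powr - p - (1 - p * u + p * (p + 1) / 2 * u^2)\<bar>"
      using w by (simp add: abs_mult)
    also have "\<dots> \<le> w * x^2 * (C * \<bar>u\<bar>^3)"
      using w C(2)[OF u] by (intro mult_left_mono) auto
    also have "\<dots> = w * (C * \<bar>d\<bar>^3 / x)"
      using x0 by (simp add: u_def abs_divide power_divide field_simps eval_nat_numeral)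
    also have "\<dots> \<le> w * (C * B^3 / x)"
      using w C(1) d x0 by (intro mult_left_mono divide_right_mono power_mono) auto
    finally show ?thesis by (simp add: w_def)
  qed
  moreover have "C * B^3 \<ge> 0" using C(1) assms by simp
  ultimately show thesis using that by blast
qed

text \<open>The limit hypotheses are kept only as inequalities beyond a threshold \<open>x0\<close>,
  stated directly for the conditional moments. \<open>B \<ge> 1\<close> is a normalisation: a jump
  from a point above \<open>2 * B\<close> then stays at or above the truncation point
  \<open>1\<close> of \<open>phi\<close>.\<close>

locale drift_process = prob_space M for M :: "'a measure" +
  fixes F :: "nat \<Rightarrow> 'a measure" and X :: "nat \<Rightarrow> 'a \<Rightarrow> real" and x0 B \<epsilon> v c\<^sub>1 :: real
  assumes subalg: "subalgebra M (F n)"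
    and F_mono: "m \<le> n \<Longrightarrow> sets (F m) \<subseteq> sets (F n)"
    and adapted: "X n \<in> borel_measurable (F n)"
    and X_nonneg: "\<omega> \<in> space M \<Longrightarrow> X n \<omega> \<ge> 0"
    and B_ge: "B \<ge> 1"
    and eps_pos: "\<epsilon> > 0"
    and v_pos: "v > 0"
    and jumps: "AE \<omega> in M. \<forall>n. \<bar>X (Suc n) \<omega> - X n \<omega>\<bar> \<le> B"
    and unbounded: "AE \<omega> in M. \<forall>y. \<exists>n. X n \<omega> > y"
    and moments: "AE \<omega> in M. X n \<omega> \<ge> x0 \<longrightarrow>
      \<epsilon> \<le> 2 * X n \<omega> * real_cond_exp M (F n) (\<lambda>\<omega>. X (Suc n) \<omega> - X n \<omega>) \<omega>
            - real_cond_exp M (F n) (\<lambda>\<omega>. (X (Suc n) \<omega> - X n \<omega>)^2) \<omega> \<and>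
      v \<le> real_cond_exp M (F n) (\<lambda>\<omega>. (X (Suc n) \<omega> - X n \<omega>)^2) \<omega> \<and>
      X n \<omega> * real_cond_exp M (F n) (\<lambda>\<omega>. X (Suc n) \<omega> - X n \<omega>) \<omega> \<le> c\<^sub>1"
begin

abbreviation "\<Delta> n \<omega> \<equiv> X (Suc n) \<omega> - X n \<omega>"
abbreviation "D1 n \<equiv> real_cond_exp M (F n) (\<lambda>\<omega>. \<Delta> n \<omega>)"
abbreviation "D2 n \<equiv> real_cond_exp M (F n) (\<lambda>\<omega>. (\<Delta> n \<omega>)^2)"

lemma space_F [simp]: "space (F n) = space M"
  using subalg[of n] by (simp add: subalgebra_def)

lemma sets_F_M: "A \<in> sets (F n) \<Longrightarrow> A \<in> sets M"
  using subalg[of n] by (auto simp: subalgebra_def)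

lemma X_measurable_F: "m \<le> n \<Longrightarrow> X m \<in> borel_measurable (F n)"
  using measurable_mono[of borel borel "F m" "F n"] adapted[of m] F_mono[of m n] by (auto simp: subalg)

lemma X_measurable [measurable]: "X n \<in> borel_measurable M"
  using measurable_from_subalg[OF subalg adapted] .

sublocale sub: sigma_finite_subalgebra M "F n" for n
  by (intro finite_measure_subalgebra_is_sigma_finite)
     (simp add: finite_measure_subalgebra_def finite_measure_axioms
        finite_measure_subalgebra_axioms_def subalg)

lemma jump_AE: "AE \<omega> in M. \<bar>\<Delta> n \<omega>\<bar> \<le> B"
  using jumps by eventually_elim auto

lemma jump_sq_AE: "AE \<omega> in M. (\<Delta> n \<omega>)^2 \<le> B^2"
  using jump_AE by eventually_elim (use B_ge in \<open>simp add: abs_le_square_iff[symmetric]\<close>)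

lemma integrable_bdd:
  fixes f :: "'a \<Rightarrow> real"
  assumes [measurable]: "f \<in> borel_measurable M" and "AE \<omega> in M. \<bar>f \<omega>\<bar> \<le> c"
  shows "integrable M f"
  using assms by (intro integrable_const_bound[of _ c]) auto

lemma integrable_bdd_mult_jump:
  fixes g :: "'a \<Rightarrow> real"
  assumes [measurable]: "g \<in> borel_measurable M" and g: "\<And>\<omega>. \<bar>g \<omega>\<bar> \<le> c"
  shows "integrable M (\<lambda>\<omega>. g \<omega> * \<Delta> n \<omega>)" "integrable M (\<lambda>\<omega>. g \<omega> * (\<Delta> n \<omega>)^2)"
proof -
  have "AE \<omega> in M. \<bar>g \<omega> * \<Delta> n \<omega>\<bar> \<le> c * B"
    using jump_AE[of n] by eventually_elim (use g in \<open>auto simp: abs_mult intro!: mult_mono order_trans[OF _ g]\<close>)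
  then show "integrable M (\<lambda>\<omega>. g \<omega> * \<Delta> n \<omega>)" by (intro integrable_bdd) measurable
  have "AE \<omega> in M. \<bar>g \<omega> * (\<Delta> n \<omega>)^2\<bar> \<le> c * B^2"
    using jump_sq_AE[of n] by eventually_elim (use g in \<open>auto simp: abs_mult intro!: mult_mono order_trans[OF _ g]\<close>)
  then show "integrable M (\<lambda>\<omega>. g \<omega> * (\<Delta> n \<omega>)^2)" by (intro integrable_bdd) measurable
qed

lemma D2_le: "AE \<omega> in M. D2 n \<omega> \<le> B^2"
  using integrable_bdd_mult_jump(2)[of "\<lambda>_. 1" 1 n] jump_sq_AE[of n]
  by (intro sub.real_cond_exp_le_c) auto

text \<open>One computation serves both directions: \<open>s = 1\<close> yields the supermartingale,
  \<open>s = - 1\<close> the submartingale. Far out, the Taylor error is beaten by the strict margin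
  \<open>\<kappa>\<close>. Testing against sets of \<open>F n\<close> expresses the one-step
  inequality without conditional expectations of \<open>phi\<close>.\<close>

lemma phi_drift:
  assumes p: "p > 0" and s: "\<bar>s\<bar> = 1" and \<kappa>: "\<kappa> > 0"
    and bound: "\<And>n. AE \<omega> in M. X n \<omega> \<ge> x0 \<longrightarrow> s * (- 2 * X n \<omega> * D1 n \<omega> + (p + 1) * D2 n \<omega>) \<le> - \<kappa>"
  shows "\<exists>x1. \<forall>n. \<forall>A\<in>sets (F n). (\<forall>\<omega>\<in>A. X n \<omega> \<ge> x1) \<longrightarrow>
    (\<integral>\<omega>. indicator A \<omega> * (s * (phi p (X (Suc n) \<omega>) - phi p (X n \<omega>))) \<partial>M) \<le> 0"
proof -
  obtain C where C: "C \<ge> 0"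
    "\<And>x d. x \<ge> 2 * B \<Longrightarrow> \<bar>d\<bar> \<le> B \<Longrightarrow>
      \<bar>phi p (x + d) - phi p x - x powr (- p - 2) * (p / 2 * (- 2 * x * d + (p + 1) * d^2))\<bar>
        \<le> x powr (- p - 2) * (C / x)"
    using phi_expansion[OF p B_ge] by metis
  define \<eta> where "\<eta> = p / 2 * \<kappa>"
  have \<eta>: "\<eta> > 0" using p \<kappa> by (simp add: \<eta>_def)
  \<comment> \<open>Three demands: the drift bound is available, the expansion is valid, and the
    Taylor error \<open>C / x\<close> is at most \<open>\<eta>\<close>.\<close>
  define x1 where "x1 = max x0 (max (2 * B) (C / \<eta>))"
  have "(\<integral>\<omega>. indicator A \<omega> * (s * (phi p (X (Suc n) \<omega>) - phi p (X n \<omega>))) \<partial>M) \<le> 0"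
    if A: "A \<in> sets (F n)" and AX: "\<And>\<omega>. \<omega> \<in> A \<Longrightarrow> X n \<omega> \<ge> x1" for n A
  proof -
    note [measurable] = A adapted
    have [measurable]: "A \<in> sets M" using A by (rule sets_F_M)
    define g where "g \<omega> = indicator A \<omega> * X n \<omega> powr (- p - 2)" for \<omega>
    \<comment> \<open>\<open>X n\<close> is unbounded, so it is absorbed into the weight: both
      \<open>g\<close> and \<open>gx\<close> are bounded \<open>F n\<close>-measurable multipliers
      and may be moved through the conditional expectation.\<close>
    define gx where "gx \<omega> = indicator A \<omega> * X n \<omega> powr (- p - 1)" for \<omega>
    have X1: "X n \<omega> \<ge> 1" "X n \<omega> \<ge> 2 * B" "X n \<omega> \<ge> x0" "C / X n \<omega> \<le> \<eta>" if "\<omega> \<in> A" for \<omega>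
    proof -
      show b: "X n \<omega> \<ge> 1" "X n \<omega> \<ge> 2 * B" "X n \<omega> \<ge> x0"
        using AX[OF that] B_ge by (auto simp: x1_def)
      have "C / \<eta> \<le> X n \<omega>" using AX[OF that] by (auto simp: x1_def)
      then show "C / X n \<omega> \<le> \<eta>" using \<eta> b(1) by (simp add: field_simps)
    qed
    have g0: "g \<omega> \<ge> 0" "gx \<omega> \<ge> 0" for \<omega> by (simp_all add: g_def gx_def)
    have gx: "gx \<omega> = g \<omega> * X n \<omega>" for \<omega>
    proof (cases "\<omega> \<in> A")
      case True
      then show ?thesis using X1(1)[OF True] powr_add[of "X n \<omega>" "- p - 2" 1]
        by (simp add: g_def gx_def minus_diff_commute)
    qed (simp add: g_def gx_def)
    have b: "\<bar>g \<omega>\<bar> \<le> 1" "\<bar>gx \<omega>\<bar> \<le> 1" for \<omega>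
      using X1(1)[of \<omega>] p by (auto simp: g_def gx_def indicator_def intro!: powr_nonpos_le_1)
    have m: "g \<in> borel_measurable (F n)" "gx \<in> borel_measurable (F n)"
      unfolding g_def gx_def by measurable
    have [measurable]: "g \<in> borel_measurable M" "gx \<in> borel_measurable M"
      using m measurable_from_subalg[OF subalg] by auto
    have i1: "integrable M (\<lambda>\<omega>. gx \<omega> * \<Delta> n \<omega>)" and i2: "integrable M (\<lambda>\<omega>. g \<omega> * (\<Delta> n \<omega>)^2)"
      using b by (auto intro!: integrable_bdd_mult_jump[of _ 1])
    have c1: "integrable M (\<lambda>\<omega>. gx \<omega> * D1 n \<omega>)"
        "(\<integral>\<omega>. gx \<omega> * D1 n \<omega> \<partial>M) = (\<integral>\<omega>. gx \<omega> * \<Delta> n \<omega> \<partial>M)"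
      by (rule sub.real_cond_exp_intg[OF i1 m(2)], measurable)+
    have c2: "integrable M (\<lambda>\<omega>. g \<omega> * D2 n \<omega>)"
        "(\<integral>\<omega>. g \<omega> * D2 n \<omega> \<partial>M) = (\<integral>\<omega>. g \<omega> * (\<Delta> n \<omega>)^2 \<partial>M)"
      by (rule sub.real_cond_exp_intg[OF i2 m(1)], measurable)+
    have ig: "integrable M g" using b by (intro integrable_bdd[of _ 1]) auto
    have "(\<integral>\<omega>. indicator A \<omega> * (s * (phi p (X (Suc n) \<omega>) - phi p (X n \<omega>))) \<partial>M)
       \<le> (\<integral>\<omega>. s * (p / 2) * (- 2 * (gx \<omega> * \<Delta> n \<omega>) + (p + 1) * (g \<omega> * (\<Delta> n \<omega>)^2)) + \<eta> * g \<omega> \<partial>M)"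
    proof (rule integral_mono_AE)
      show "integrable M (\<lambda>\<omega>. indicator A \<omega> * (s * (phi p (X (Suc n) \<omega>) - phi p (X n \<omega>))))"
      proof (rule integrable_bdd[of _ 1])
        have "\<bar>phi p x - phi p y\<bar> \<le> 1" for x y
          using phi_le_1[OF p, of x] phi_le_1[OF p, of y] phi_pos[of p x] phi_pos[of p y] by linarith
        then show "AE \<omega> in M. \<bar>indicator A \<omega> * (s * (phi p (X (Suc n) \<omega>) - phi p (X n \<omega>)))\<bar> \<le> 1"
          by (auto simp: abs_mult s indicator_def)
      qed measurable
      show "integrable M (\<lambda>\<omega>. s * (p / 2) * (- 2 * (gx \<omega> * \<Delta> n \<omega>) + (p + 1) * (g \<omega> * (\<Delta> n \<omega>)^2)) + \<eta> * g \<omega>)"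
        using i1 i2 ig by (intro Bochner_Integration.integrable_add integrable_mult_right)
      show "AE \<omega> in M. indicator A \<omega> * (s * (phi p (X (Suc n) \<omega>) - phi p (X n \<omega>)))
        \<le> s * (p / 2) * (- 2 * (gx \<omega> * \<Delta> n \<omega>) + (p + 1) * (g \<omega> * (\<Delta> n \<omega>)^2)) + \<eta> * g \<omega>"
        using jump_AE[of n]
      proof eventually_elim
        case (elim \<omega>)
        show ?case
        proof (cases "\<omega> \<in> A")
          case True
          define q where "q = - 2 * X n \<omega> * \<Delta> n \<omega> + (p + 1) * (\<Delta> n \<omega>)^2"
          define r where "r = phi p (X (Suc n) \<omega>) - phi p (X n \<omega>) - g \<omega> * (p / 2 * q)"
          have "\<bar>r\<bar> \<le> g \<omega> * (C / X n \<omega>)"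
            using C(2)[of "X n \<omega>" "\<Delta> n \<omega>"] X1(2)[OF True] elim True by (simp add: r_def q_def g_def)
          also have "\<dots> \<le> g \<omega> * \<eta>" using X1(4)[OF True] g0(1) by (rule mult_left_mono)
          finally have "\<bar>s * r\<bar> \<le> \<eta> * g \<omega>" unfolding abs_mult s by (simp only: mult_1_left mult.commute)
          then have "s * r \<le> \<eta> * g \<omega>" by linarith
          then have "s * (phi p (X (Suc n) \<omega>) - phi p (X n \<omega>)) \<le> s * (g \<omega> * (p / 2 * q)) + \<eta> * g \<omega>"
            by (simp add: r_def right_diff_distrib)
          then show ?thesis using True by (simp add: q_def gx algebra_simps)
        qed (simp add: g_def gx_def)
      qed
    qed
    also have "\<dots> = s * (p / 2) * (- 2 * (\<integral>\<omega>. gx \<omega> * \<Delta> n \<omega> \<partial>M)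
        + (p + 1) * (\<integral>\<omega>. g \<omega> * (\<Delta> n \<omega>)^2 \<partial>M)) + \<eta> * (\<integral>\<omega>. g \<omega> \<partial>M)"
      using i1 i2 ig by simp
    also have "\<dots> = s * (p / 2) * (- 2 * (\<integral>\<omega>. gx \<omega> * D1 n \<omega> \<partial>M)
        + (p + 1) * (\<integral>\<omega>. g \<omega> * D2 n \<omega> \<partial>M)) + \<eta> * (\<integral>\<omega>. g \<omega> \<partial>M)"
      using c1(2) c2(2) by simp
    also have "\<dots> = (\<integral>\<omega>. s * (p / 2) * (- 2 * (gx \<omega> * D1 n \<omega>) + (p + 1) * (g \<omega> * D2 n \<omega>)) + \<eta> * g \<omega> \<partial>M)"
      using c1(1) c2(1) ig by simp
    also have "\<dots> \<le> (\<integral>\<omega>. 0 \<partial>M)"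
    proof (rule integral_mono_AE)
      show "integrable M (\<lambda>\<omega>. s * (p / 2) * (- 2 * (gx \<omega> * D1 n \<omega>) + (p + 1) * (g \<omega> * D2 n \<omega>)) + \<eta> * g \<omega>)"
        using c1(1) c2(1) ig by (intro Bochner_Integration.integrable_add integrable_mult_right)
      show "AE \<omega> in M. s * (p / 2) * (- 2 * (gx \<omega> * D1 n \<omega>) + (p + 1) * (g \<omega> * D2 n \<omega>)) + \<eta> * g \<omega> \<le> 0"
        using bound[of n]
      proof eventually_elim
        case (elim \<omega>)
        show ?case
        proof (cases "\<omega> \<in> A")
          case True
          then have "s * (- 2 * X n \<omega> * D1 n \<omega> + (p + 1) * D2 n \<omega>) \<le> - \<kappa>" using elim X1 by auto
          then have "g \<omega> * (p / 2) * (s * (- 2 * X n \<omega> * D1 n \<omega> + (p + 1) * D2 n \<omega>)) \<le> g \<omega> * (p / 2) * (- \<kappa>)"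
            using g0 p by (intro mult_left_mono) auto
          then show ?thesis by (simp add: gx \<eta>_def algebra_simps)
        qed (simp add: g_def gx_def)
      qed
    qed simp
    finally show ?thesis by simp
  qed
  then show ?thesis by blast
qed

lemma phi_integrable [simp]:
  assumes "p > 0" "A \<in> sets M"
  shows "integrable M (\<lambda>\<omega>. indicator A \<omega> * phi p (X n \<omega>))"
  using assms by (intro integrable_bdd[of _ 1])
    (auto simp: abs_mult indicator_def abs_of_pos[OF phi_pos] phi_le_1)

lemma phi_supermartingale:
  obtains p x1 where "p > 0" "x1 \<ge> 1"
    "\<And>n A. A \<in> sets (F n) \<Longrightarrow> (\<And>\<omega>. \<omega> \<in> A \<Longrightarrow> X n \<omega> \<ge> x1) \<Longrightarrow>
      (\<integral>\<omega>. indicator A \<omega> * phi p (X (Suc n) \<omega>) \<partial>M) \<le> (\<integral>\<omega>. indicator A \<omega> * phi p (X n \<omega>) \<partial>M)"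
proof -
  \<comment> \<open>So small that the extra term \<open>p * D2 n \<omega>\<close> uses up at most
    half of the margin \<open>\<epsilon>\<close>.\<close>
  define p where "p = \<epsilon> / (2 * B^2)"
  have p: "p > 0" using eps_pos B_ge by (simp add: p_def)
  have pB: "p * B^2 = \<epsilon> / 2" using B_ge by (simp add: p_def)
  have bd: "AE \<omega> in M. X n \<omega> \<ge> x0 \<longrightarrow> 1 * (- 2 * X n \<omega> * D1 n \<omega> + (p + 1) * D2 n \<omega>) \<le> - (\<epsilon> / 2)" for n
    using moments[of n] D2_le[of n]
  proof eventually_elim
    case (elim \<omega>)
    have "p * D2 n \<omega> \<le> p * B^2" using elim p by (intro mult_left_mono) auto
    then have "p * D2 n \<omega> \<le> \<epsilon> / 2" by (simp only: pB)
    then show ?case using elim by (auto simp: algebra_simps)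
  qed
  obtain x1 where x1: "\<And>n A. A \<in> sets (F n) \<Longrightarrow> (\<And>\<omega>. \<omega> \<in> A \<Longrightarrow> X n \<omega> \<ge> x1) \<Longrightarrow>
    (\<integral>\<omega>. indicator A \<omega> * (1 * (phi p (X (Suc n) \<omega>) - phi p (X n \<omega>))) \<partial>M) \<le> 0"
    using phi_drift[OF p abs_one half_gt_zero[OF eps_pos] bd] by blast
  show thesis
  proof (rule that[of p "max 1 x1"])
    fix n A assume A: "A \<in> sets (F n)" and X: "\<And>\<omega>. \<omega> \<in> A \<Longrightarrow> X n \<omega> \<ge> max 1 x1"
    have "(\<integral>\<omega>. indicator A \<omega> * (1 * (phi p (X (Suc n) \<omega>) - phi p (X n \<omega>))) \<partial>M) \<le> 0"
      by (rule x1[OF A]) (rule order.trans[OF max.cobounded2 X])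
    then show "(\<integral>\<omega>. indicator A \<omega> * phi p (X (Suc n) \<omega>) \<partial>M) \<le> (\<integral>\<omega>. indicator A \<omega> * phi p (X n \<omega>) \<partial>M)"
      using p sets_F_M[OF A] by (simp add: right_diff_distrib)
  qed (use p in auto)
qed

lemma phi_submartingale:
  obtains a x1 where "a \<ge> 1" "x1 \<ge> 1"
    "\<And>n A. A \<in> sets (F n) \<Longrightarrow> (\<And>\<omega>. \<omega> \<in> A \<Longrightarrow> X n \<omega> \<ge> x1) \<Longrightarrow>
      (\<integral>\<omega>. indicator A \<omega> * phi a (X (Suc n) \<omega>) \<partial>M) \<ge> (\<integral>\<omega>. indicator A \<omega> * phi a (X n \<omega>) \<partial>M)"
proof -
  \<comment> \<open>Makes \<open>(a + 1) * v\<close> exceed \<open>2 * c\<^sub>1\<close> by at least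
    one; the leading \<open>1\<close> gives \<open>a \<ge> 1\<close>, which
    \<open>powr_neg_diff_ge\<close> asks for.\<close>
  define a where "a = 1 + (1 + 2 * \<bar>c\<^sub>1\<bar>) / v"
  have a: "a \<ge> 1" using v_pos by (simp add: a_def)
  then have a0: "a > 0" by simp
  have s: "\<bar>- 1 :: real\<bar> = 1" by simp
  have av: "(a + 1) * v \<ge> 1 + 2 * \<bar>c\<^sub>1\<bar>" using v_pos by (simp add: a_def field_simps)
  have bd: "AE \<omega> in M. X n \<omega> \<ge> x0 \<longrightarrow> - 1 * (- 2 * X n \<omega> * D1 n \<omega> + (a + 1) * D2 n \<omega>) \<le> - 1" for n
    using moments[of n]
  proof eventually_elim
    case (elim \<omega>)
    show ?case
    proof
      assume "X n \<omega> \<ge> x0"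
      then have e: "v \<le> D2 n \<omega>" "X n \<omega> * D1 n \<omega> \<le> c\<^sub>1" using elim by auto
      have "(a + 1) * v \<le> (a + 1) * D2 n \<omega>" using e a by (intro mult_left_mono) auto
      moreover have "- 1 * (- 2 * X n \<omega> * D1 n \<omega> + (a + 1) * D2 n \<omega>) = 2 * (X n \<omega> * D1 n \<omega>) - (a + 1) * D2 n \<omega>"
        by simp
      ultimately show "- 1 * (- 2 * X n \<omega> * D1 n \<omega> + (a + 1) * D2 n \<omega>) \<le> - 1" using e(2) av by linarith
    qed
  qed
  obtain x1 where x1: "\<And>n A. A \<in> sets (F n) \<Longrightarrow> (\<And>\<omega>. \<omega> \<in> A \<Longrightarrow> X n \<omega> \<ge> x1) \<Longrightarrow>
    (\<integral>\<omega>. indicator A \<omega> * (- 1 * (phi a (X (Suc n) \<omega>) - phi a (X n \<omega>))) \<partial>M) \<le> 0"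
    using phi_drift[OF a0 s zero_less_one bd] by blast
  show thesis
  proof (rule that[of a "max 1 x1"])
    fix n A assume A: "A \<in> sets (F n)" and X: "\<And>\<omega>. \<omega> \<in> A \<Longrightarrow> X n \<omega> \<ge> max 1 x1"
    have "(\<integral>\<omega>. indicator A \<omega> * (- 1 * (phi a (X (Suc n) \<omega>) - phi a (X n \<omega>))) \<partial>M) \<le> 0"
      by (rule x1[OF A]) (rule order.trans[OF max.cobounded2 X])
    then show "(\<integral>\<omega>. indicator A \<omega> * phi a (X (Suc n) \<omega>) \<partial>M) \<ge> (\<integral>\<omega>. indicator A \<omega> * phi a (X n \<omega>) \<partial>M)"
      using a sets_F_M[OF A] by (simp add: right_diff_distrib)
  qed (use a in auto)
qed

end

subsection \<open>Escape and crossing probabilities\<close>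

text \<open>Mean value theorem for \<open>(1 + u) powr - p\<close> with
  \<open>u = 1 / z \<le> 1\<close>: between \<open>1\<close> and \<open>2\<close> the slope is at
  least \<open>p * 2 powr (- p - 1)\<close> in size. This relative loss over one unit is the source
  of the escape probability.\<close>

lemma one_minus_powr_ge:
  fixes p :: real
  assumes "p > 0" "z \<ge> 1"
  shows "(z + 1) powr - p \<le> z powr - p * (1 - p * 2 powr (- p - 1) / z)"
proof -
  define u where "u = 1 / z"
  have u: "u > 0" "u \<le> 1" using assms by (auto simp: u_def)
  have "\<exists>\<xi>. 1 < \<xi> \<and> \<xi> < 1 + u \<and> (1 + u) powr - p - 1 powr - p = (1 + u - 1) * (- p * \<xi> powr (- p - 1))"
    using u by (intro MVT2) (auto intro!: derivative_eq_intros)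
  then obtain \<xi> where \<xi>: "1 < \<xi>" "\<xi> < 1 + u" "(1 + u) powr - p = 1 - u * (p * \<xi> powr (- p - 1))"
    by auto
  have "2 powr (- p - 1) \<le> \<xi> powr (- p - 1)"
    using \<xi> u assms by (intro powr_mono2') auto
  then have "u * (p * 2 powr (- p - 1)) \<le> u * (p * \<xi> powr (- p - 1))"
    using u assms by (intro mult_left_mono) auto
  then have *: "(1 + u) powr - p \<le> 1 - p * 2 powr (- p - 1) / z"
    using \<xi>(3) by (simp add: u_def)
  have "z + 1 = z * (1 + u)" using assms by (simp add: u_def field_simps)
  then have "(z + 1) powr - p = z powr - p * (1 + u) powr - p"
    using assms u by (simp add: powr_mult)
  then show ?thesis using * by (simp add: mult_left_mono)
qed

text \<open>Mean value theorem over a window of width \<open>2 * B\<close>. The window lies above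
  \<open>y / 2\<close>, so the power at the intermediate point is comparable with that at
  \<open>y\<close>.\<close>

lemma powr_neg_diff_le:
  fixes a :: real
  assumes "a > 0" "B > 0" "y \<ge> 2 * B"
  shows "(y - B) powr - a - (y + B) powr - a \<le> y powr - a * (B * a * 2 powr (a + 2) / y)"
proof -
  have "\<exists>\<xi>. y - B < \<xi> \<and> \<xi> < y + B \<and>
      (y + B) powr - a - (y - B) powr - a = (y + B - (y - B)) * (- a * \<xi> powr (- a - 1))"
    using assms by (intro MVT2) (auto intro!: derivative_eq_intros)
  then obtain \<xi> where \<xi>: "y - B < \<xi>" "(y - B) powr - a - (y + B) powr - a = 2 * B * (a * \<xi> powr (- a - 1))"
    by (auto simp: left_diff_distrib)
  have "\<xi> powr (- a - 1) \<le> (y / 2) powr (- a - 1)"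
    using \<xi> assms by (intro powr_mono2') auto
  also have "\<dots> = y powr - a * (2 powr (a + 1) / y)"
    using assms by (simp add: powr_divide powr_diff powr_minus powr_add field_simps)
  finally have "2 * B * (a * \<xi> powr (- a - 1)) \<le> 2 * B * (a * (y powr - a * (2 powr (a + 1) / y)))"
    using assms by (intro mult_left_mono) auto
  then show ?thesis using \<xi>(2) by (simp add: powr_add mult_ac)
qed

text \<open>As \<open>y / y' \<le> 1\<close>, an exponent \<open>a \<ge> 1\<close> only lowers it,
  so the relative drop is at least that for exponent \<open>1\<close>.\<close>

lemma powr_neg_diff_ge:
  fixes a :: real
  assumes "a \<ge> 1" "0 < y" "y \<le> y'"
  shows "y powr - a - y' powr - a \<ge> y powr - a * ((y' - y) / y')"
proof -
  have "(y / y') powr a \<le> (y / y') powr 1"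
    using assms by (intro powr_mono') auto
  then have "y powr - a * (y / y') powr a \<le> y powr - a * (y / y')"
    using assms by (intro mult_left_mono) auto
  moreover have "y powr - a * (y / y') powr a = y' powr - a"
    using assms by (simp add: powr_divide powr_minus field_simps)
  ultimately show ?thesis using assms by (simp add: field_simps)
qed

context drift_process
begin

lemma sets_F_lift: "A \<in> sets (F n) \<Longrightarrow> n \<le> m \<Longrightarrow> A \<in> sets (F m)"
  using F_mono by blast

text \<open>The events below are written, or rewritten, as nested sets of this shape, so that a
  single rule settles their measurability at the right time.\<close>

lemma sets_F_all:
  assumes "A \<in> sets (F m)" "\<And>i. i \<in> I \<Longrightarrow> i \<le> m" "Q \<in> sets borel"
  shows "{\<omega> \<in> A. \<forall>i\<in>I. X i \<omega> \<in> Q} \<in> sets (F m)"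
proof -
  have "{\<omega> \<in> space (F m). \<forall>i. i \<in> I \<longrightarrow> X i \<omega> \<in> Q} \<in> sets (F m)"
  proof (rule sets.sets_Collect_countable_All)
    show "{\<omega> \<in> space (F m). i \<in> I \<longrightarrow> X i \<omega> \<in> Q} \<in> sets (F m)" for i
    proof (cases "i \<in> I")
      case True
      then show ?thesis
        using measurable_sets[OF X_measurable_F[OF assms(2)[OF True]] assms(3)]
        by (simp add: vimage_def Int_def conj_commute)
    qed (use sets.top[of "F m"] in simp)
  qed
  moreover have "{\<omega> \<in> A. \<forall>i\<in>I. X i \<omega> \<in> Q} = A \<inter> {\<omega> \<in> space (F m). \<forall>i. i \<in> I \<longrightarrow> X i \<omega> \<in> Q}"
    using sets.sets_into_space[OF assms(1)] by auto
  ultimately show ?thesis using assms(1) by auto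
qed

lemma sets_M_all:
  assumes "A \<in> sets M" "Q \<in> sets borel"
  shows "{\<omega> \<in> A. \<forall>i\<in>I. X i \<omega> \<in> Q} \<in> sets M"
proof -
  have "{\<omega> \<in> space M. \<forall>i. i \<in> I \<longrightarrow> X i \<omega> \<in> Q} \<in> sets M"
    using assms(2) by measurable
  moreover have "{\<omega> \<in> A. \<forall>i\<in>I. X i \<omega> \<in> Q} = A \<inter> {\<omega> \<in> space M. \<forall>i. i \<in> I \<longrightarrow> X i \<omega> \<in> Q}"
    using sets.sets_into_space[OF assms(1)] by auto
  ultimately show ?thesis using assms(1) by auto
qed

lemma indicator_integrable [simp]:
  assumes "A \<in> sets M"
  shows "integrable M (\<lambda>\<omega>. indicator A \<omega> * (c::real))" "integrable M (indicat_real A)"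
  using assms by (auto intro!: integrable_bdd[of _ "\<bar>c\<bar>"] integrable_bdd[of _ 1] simp: indicator_def)

lemma integral_indicator_mult: "A \<in> sets M \<Longrightarrow> (\<integral>\<omega>. indicator A \<omega> * (c::real) \<partial>M) = prob A * c"
  by simp

text \<open>Optional stopping of the supermartingale at the exit from the half line above
  \<open>z\<close>, carried out as an induction on time. The starting value is at most
  \<open>phi p (z + 1)\<close>, which is below \<open>phi p z\<close> by the factor
  \<open>1 - c / z\<close>, so at most this fraction of \<open>A\<close> can ever exit.\<close>

lemma escape_lower:
  obtains c x1 where "c > 0" "x1 \<ge> 1"
    "\<And>n A z. z \<ge> x1 \<Longrightarrow> A \<in> sets (F n) \<Longrightarrow> (\<And>\<omega>. \<omega> \<in> A \<Longrightarrow> X n \<omega> \<ge> z + 1) \<Longrightarrow>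
      prob {\<omega> \<in> A. \<forall>i\<in>{n..}. X i \<omega> \<in> {z..}} \<ge> c / z * prob A"
proof -
  obtain p x1 where p: "p > 0" and x1: "x1 \<ge> 1" and
    super: "\<And>n A. A \<in> sets (F n) \<Longrightarrow> (\<And>\<omega>. \<omega> \<in> A \<Longrightarrow> X n \<omega> \<ge> x1) \<Longrightarrow>
      (\<integral>\<omega>. indicator A \<omega> * phi p (X (Suc n) \<omega>) \<partial>M) \<le> (\<integral>\<omega>. indicator A \<omega> * phi p (X n \<omega>) \<partial>M)"
    by (rule phi_supermartingale) blast
  define c where "c = p * 2 powr (- p - 1)"
  have "prob {\<omega> \<in> A. \<forall>i\<in>{n..}. X i \<omega> \<in> {z..}} \<ge> c / z * prob A"
    if z: "z \<ge> x1" and A: "A \<in> sets (F n)" and AX: "\<And>\<omega>. \<omega> \<in> A \<Longrightarrow> X n \<omega> \<ge> z + 1" for n A z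
  proof -
    define S where "S m = {\<omega> \<in> A. \<forall>i\<in>{n..m}. X i \<omega> \<in> {z..}}" for m
    have AM [measurable]: "A \<in> sets M" using A by (rule sets_F_M)
    have SF: "S m \<in> sets (F m)" if "m \<ge> n" for m
      unfolding S_def using sets_F_lift[OF A that] by (intro sets_F_all) auto
    have [measurable]: "S m \<in> sets M" for m
      unfolding S_def by (intro sets_M_all) auto
    have Sdec: "S (Suc m) \<subseteq> S m" for m by (auto simp: S_def)
    have SA: "S m \<subseteq> A" for m by (auto simp: S_def)
    have fz: "phi p (z + 1) \<le> phi p z * (1 - c / z)"
      using one_minus_powr_ge[OF p, of z] z x1 by (simp add: phi_eq c_def)
    \<comment> \<open>Paths still inside carry their current value; paths already out are credited
      with \<open>phi p z\<close>, a lower bound for the value on exit since \<open>phi p\<close> is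
      decreasing.\<close>
    have step: "(\<integral>\<omega>. indicator (S m) \<omega> * phi p (X m \<omega>) \<partial>M) + phi p z * (prob A - prob (S m))
        \<le> phi p (z + 1) * prob A" if "m \<ge> n" for m
      using that
    proof (induction m rule: dec_induct)
      case base
      have "S n = A" using AX by (fastforce simp: S_def)
      moreover have "(\<integral>\<omega>. indicator A \<omega> * phi p (X n \<omega>) \<partial>M) \<le> (\<integral>\<omega>. indicator A \<omega> * phi p (z + 1) \<partial>M)"
        using p AX by (intro integral_mono phi_integrable indicator_integrable) (auto simp: indicator_def intro: phi_antimono)
      ultimately show ?case by (simp add: mult.commute)
    next
      case (step m)
      have "(\<integral>\<omega>. indicator (S (Suc m)) \<omega> * phi p (X (Suc m) \<omega>) + indicator (S m - S (Suc m)) \<omega> * phi p z \<partial>M)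
          \<le> (\<integral>\<omega>. indicator (S m) \<omega> * phi p (X (Suc m) \<omega>) \<partial>M)"
      proof (rule integral_mono)
        show "indicator (S (Suc m)) \<omega> * phi p (X (Suc m) \<omega>) + indicator (S m - S (Suc m)) \<omega> * phi p z
            \<le> indicator (S m) \<omega> * phi p (X (Suc m) \<omega>)" for \<omega>
        proof (cases "\<omega> \<in> S m - S (Suc m)")
          case True
          then have "X (Suc m) \<omega> \<le> z" by (auto simp: S_def le_Suc_eq)
          then show ?thesis using True p by (simp add: phi_antimono)
        qed (use Sdec[of m] in \<open>auto simp: indicator_def\<close>)
      qed (use p in \<open>auto intro!: Bochner_Integration.integrable_add indicator_integrable\<close>)
      moreover have "prob (S m - S (Suc m)) = prob (S m) - prob (S (Suc m))"
        using Sdec by (intro finite_measure_Diff) auto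
      moreover have "(\<integral>\<omega>. indicator (S m) \<omega> * phi p (X (Suc m) \<omega>) \<partial>M)
          \<le> (\<integral>\<omega>. indicator (S m) \<omega> * phi p (X m \<omega>) \<partial>M)"
      proof (intro super SF step(1))
        show "x1 \<le> X m \<omega>" if "\<omega> \<in> S m" for \<omega>
          using that step(1) z by (auto simp: S_def intro: order.trans[of _ z])
      qed
      ultimately have "(\<integral>\<omega>. indicator (S (Suc m)) \<omega> * phi p (X (Suc m) \<omega>) \<partial>M)
          + (prob (S m) - prob (S (Suc m))) * phi p z \<le> (\<integral>\<omega>. indicator (S m) \<omega> * phi p (X m \<omega>) \<partial>M)"
        using p by simp
      then show ?case using step.IH by (simp add: algebra_simps)
    qed
    have ge: "prob (S m) \<ge> c / z * prob A" for m
    proof -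
      \<comment> \<open>The invariant only starts at time \<open>n\<close>; smaller indices follow
        because \<open>S\<close> is decreasing.\<close>
      define m' where "m' = max m n"
      have "0 \<le> (\<integral>\<omega>. indicator (S m') \<omega> * phi p (X m' \<omega>) \<partial>M)"
        using phi_pos by (intro integral_nonneg_AE) (simp add: less_imp_le)
      then have "phi p z * (prob A - prob (S m')) \<le> phi p (z + 1) * prob A"
        using step[of m'] by (simp add: m'_def)
      also have "\<dots> \<le> phi p z * (1 - c / z) * prob A"
        using fz by (intro mult_right_mono) auto
      finally have "phi p z * (prob A - prob (S m')) \<le> phi p z * ((1 - c / z) * prob A)"
        by (simp add: mult.assoc)
      then have "prob A - prob (S m') \<le> (1 - c / z) * prob A"
        using phi_pos[of p z] by (simp only: mult_le_cancel_left_pos)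
      moreover have "prob (S m') \<le> prob (S m)"
        by (intro finite_measure_mono) (auto simp: S_def m'_def)
      ultimately show ?thesis by (simp add: algebra_simps)
    qed
    have "(\<lambda>m. prob (S m)) \<longlonglongrightarrow> prob (\<Inter>m. S m)"
      using Sdec by (intro finite_Lim_measure_decseq) (auto intro!: decseq_SucI)
    then have "c / z * prob A \<le> prob (\<Inter>m. S m)"
      by (rule LIMSEQ_le_const) (use ge in auto)
    also have "(\<Inter>m. S m) = {\<omega> \<in> A. \<forall>i\<in>{n..}. X i \<omega> \<in> {z..}}"
    proof (intro equalityI subsetI)
      fix \<omega> assume \<omega>: "\<omega> \<in> (\<Inter>m. S m)"
      then have "\<omega> \<in> A" using SA by blast
      moreover have "X i \<omega> \<ge> z" if "i \<ge> n" for i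
      proof -
        have "\<omega> \<in> S i" using \<omega> by blast
        then show ?thesis using that by (auto simp: S_def)
      qed
      ultimately show "\<omega> \<in> {\<omega> \<in> A. \<forall>i\<in>{n..}. X i \<omega> \<in> {z..}}" by auto
    qed (auto simp: S_def)
    finally show ?thesis .
  qed
  note main = this
  have c: "c > 0" using p by (simp add: c_def)
  show thesis by (rule that[OF c x1]) (rule main; blast)
qed

text \<open>Optional stopping of the submartingale on the strip from \<open>y\<close> to
  \<open>y'\<close>. A nonnegative function \<open>h\<close> is at most of order
  \<open>y powr - a / y\<close> at the start and at least \<open>y powr - a * (y' - y) / y'\<close>
  at the top; the quotient is the bound. The crossing times are summed, not united, because later
  each term is continued by another estimate from that time on.\<close>

lemma crossing_upper:
  obtains C x1 where "C > 0" "x1 \<ge> 1" "x1 \<ge> B"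
    "\<And>n N A y y'. y \<ge> x1 \<Longrightarrow> y' > y + B \<Longrightarrow> A \<in> sets (F n) \<Longrightarrow>
      (\<And>\<omega>. \<omega> \<in> A \<Longrightarrow> y \<le> X n \<omega> \<and> X n \<omega> \<le> y + B) \<Longrightarrow>
      (\<Sum>m\<in>{n<..N}. prob {\<omega> \<in> A. (\<forall>i\<in>{n..<m}. X i \<omega> \<in> {y..<y'}) \<and> X m \<omega> \<ge> y'})
        \<le> C * y' / (y * (y' - y)) * prob A"
proof -
  obtain a x1 where a: "a \<ge> 1" and x1: "x1 \<ge> 1" and
    sub: "\<And>n A. A \<in> sets (F n) \<Longrightarrow> (\<And>\<omega>. \<omega> \<in> A \<Longrightarrow> X n \<omega> \<ge> x1) \<Longrightarrow>
      (\<integral>\<omega>. indicator A \<omega> * phi a (X (Suc n) \<omega>) \<partial>M) \<ge> (\<integral>\<omega>. indicator A \<omega> * phi a (X n \<omega>) \<partial>M)"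
    by (rule phi_submartingale) blast
  have a0: "a > 0" using a by simp
  define C where "C = B * a * 2 powr (a + 2)"
  have C: "C > 0" using a0 B_ge by (simp add: C_def)
  have "(\<Sum>m\<in>{n<..N}. prob {\<omega> \<in> A. (\<forall>i\<in>{n..<m}. X i \<omega> \<in> {y..<y'}) \<and> X m \<omega> \<ge> y'})
        \<le> C * y' / (y * (y' - y)) * prob A"
    if y: "y \<ge> max x1 (2 * B)" and y': "y' > y + B" and A: "A \<in> sets (F n)"
      and AX: "\<And>\<omega>. \<omega> \<in> A \<Longrightarrow> y \<le> X n \<omega> \<and> X n \<omega> \<le> y + B" for n N A y y'
  proof -
    \<comment> \<open>The zero is placed at \<open>y - B\<close>: a path that drops below
      \<open>y\<close> lands no lower than this, so it still has nonnegative value and can be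
      discarded.\<close>
    define h where "h x = phi a (y - B) - phi a x" for x
    have h_meas [measurable]: "h \<in> borel_measurable borel" unfolding h_def by measurable
    have h_mono: "x \<le> x' \<Longrightarrow> h x \<le> h x'" for x x'
      using phi_antimono[OF a0] by (simp add: h_def)
    have h_nonneg: "x \<ge> y - B \<Longrightarrow> h x \<ge> 0" for x
      using h_mono[of "y - B" x] by (simp add: h_def)
    define S where "S m = {\<omega> \<in> A. \<forall>i\<in>{n..m}. X i \<omega> \<in> {y..<y'}}" for m
    define D where "D m = {\<omega> \<in> A. (\<forall>i\<in>{n..<m}. X i \<omega> \<in> {y..<y'}) \<and> X m \<omega> \<ge> y'}" for m
    have AM [measurable]: "A \<in> sets M" using A by (rule sets_F_M)
    have SF: "S m \<in> sets (F m)" if "m \<ge> n" for m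
      unfolding S_def using sets_F_lift[OF A that] by (intro sets_F_all) auto
    have [measurable]: "S m \<in> sets M" for m
      unfolding S_def by (intro sets_M_all) auto
    have [measurable]: "D m \<in> sets M" for m
    proof -
      have "D m = {\<omega> \<in> {\<omega> \<in> A. \<forall>i\<in>{n..<m}. X i \<omega> \<in> {y..<y'}}. \<forall>i\<in>{m}. X i \<omega> \<in> {y'..}}"
        by (auto simp: D_def)
      also have "\<dots> \<in> sets M" by (intro sets_M_all) auto
      finally show ?thesis .
    qed
    have int: "integrable M (\<lambda>\<omega>. indicator E \<omega> * h (X m \<omega>))" if "E \<in> sets M" for E m
      unfolding h_def right_diff_distrib using that a0
      by (intro Bochner_Integration.integrable_diff phi_integrable indicator_integrable) auto
    have step: "(\<integral>\<omega>. indicator (S m) \<omega> * h (X m \<omega>) \<partial>M) + h y' * (\<Sum>l\<in>{n<..m}. prob (D l))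
        \<le> h (y + B) * prob A" if "m \<ge> n" for m
      using that
    proof (induction m rule: dec_induct)
      case base
      have "S n = A" using AX y' by (fastforce simp: S_def)
      moreover have "(\<integral>\<omega>. indicator A \<omega> * h (X n \<omega>) \<partial>M) \<le> (\<integral>\<omega>. indicator A \<omega> * h (y + B) \<partial>M)"
        using AX h_mono by (intro integral_mono int indicator_integrable) (auto simp: indicator_def)
      ultimately show ?case by (simp add: mult.commute)
    next
      case (step m)
      have "(\<integral>\<omega>. indicator (S (Suc m)) \<omega> * h (X (Suc m) \<omega>) + indicator (D (Suc m)) \<omega> * h y' \<partial>M)
          \<le> (\<integral>\<omega>. indicator (S m) \<omega> * h (X (Suc m) \<omega>) \<partial>M)"
      proof (rule integral_mono_AE)
        show "AE \<omega> in M. indicator (S (Suc m)) \<omega> * h (X (Suc m) \<omega>) + indicator (D (Suc m)) \<omega> * h y'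
            \<le> indicator (S m) \<omega> * h (X (Suc m) \<omega>)"
          using jump_AE[of m]
        proof eventually_elim
          case (elim \<omega>)
          have "{n..<Suc m} = {n..m}" by auto
          then have DS: "\<omega> \<in> D (Suc m) \<Longrightarrow> \<omega> \<in> S m \<and> X (Suc m) \<omega> \<ge> y'" by (auto simp: D_def S_def)
          have SS: "\<omega> \<in> S (Suc m) \<Longrightarrow> \<omega> \<in> S m \<and> X (Suc m) \<omega> < y'" using step(1) by (auto simp: S_def)
          have "\<omega> \<in> S m \<Longrightarrow> X (Suc m) \<omega> \<ge> y - B"
          proof -
            assume "\<omega> \<in> S m"
            then have "X m \<omega> \<ge> y" using step(1) by (auto simp: S_def)
            then show ?thesis using elim by linarith
          qed
          then show ?case using DS SS h_mono[of y' "X (Suc m) \<omega>"] h_nonneg[of "X (Suc m) \<omega>"]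
            by (auto simp: indicator_def)
        qed
      qed (auto intro!: int Bochner_Integration.integrable_add)
      moreover have "(\<integral>\<omega>. indicator (S m) \<omega> * h (X (Suc m) \<omega>) \<partial>M)
          \<le> (\<integral>\<omega>. indicator (S m) \<omega> * h (X m \<omega>) \<partial>M)"
      proof -
        have "(\<integral>\<omega>. indicator (S m) \<omega> * phi a (X (Suc m) \<omega>) \<partial>M) \<ge> (\<integral>\<omega>. indicator (S m) \<omega> * phi a (X m \<omega>) \<partial>M)"
        proof (intro sub SF step(1))
          show "x1 \<le> X m \<omega>" if "\<omega> \<in> S m" for \<omega>
            using that step(1) y by (auto simp: S_def intro: order.trans[of _ y])
        qed
        then show ?thesis using a0 by (simp add: h_def right_diff_distrib)
      qed
      moreover have "(\<Sum>l\<in>{n<..Suc m}. prob (D l)) = (\<Sum>l\<in>{n<..m}. prob (D l)) + prob (D (Suc m))"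
      proof -
        have "{n<..Suc m} = insert (Suc m) {n<..m}" using step(1) by auto
        then show ?thesis by simp
      qed
      ultimately show ?case using step.IH int by (simp add: algebra_simps)
    qed
    have "(\<Sum>m\<in>{n<..N}. prob (D m)) \<le> C * y' / (y * (y' - y)) * prob A"
    proof (cases "N \<ge> n")
      case True
      have "0 \<le> (\<integral>\<omega>. indicator (S N) \<omega> * h (X N \<omega>) \<partial>M)"
      proof (rule integral_nonneg_AE, rule AE_I2)
        fix \<omega>
        show "0 \<le> indicator (S N) \<omega> * h (X N \<omega>)"
        proof (cases "\<omega> \<in> S N")
          case True
          then have "X N \<omega> \<ge> y" using \<open>N \<ge> n\<close> by (auto simp: S_def)
          then show ?thesis using B_ge by (simp add: h_nonneg)
        qed simp
      qed
      then have 1: "h y' * (\<Sum>l\<in>{n<..N}. prob (D l)) \<le> h (y + B) * prob A"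
        using step[OF True] by simp
      define w where "w = y powr - a"
      have yp: "y > 0" "y \<ge> 1" "y - B \<ge> 1" using y x1 B_ge by auto
      have w: "w > 0" using yp by (simp add: w_def)
      have hB: "h (y + B) \<le> w * (C / y)"
        using powr_neg_diff_le[of a B y] a0 B_ge y yp by (simp add: h_def phi_eq w_def C_def)
      have "w * ((y' - y) / y') \<le> phi a y - phi a y'"
        using powr_neg_diff_ge[of a y y'] a yp y' B_ge by (simp add: phi_eq w_def)
      also have "\<dots> \<le> h y'" using phi_antimono[OF a0, of "y - B" y] B_ge by (simp add: h_def)
      finally have hy': "w * ((y' - y) / y') \<le> h y'" .
      have "w * ((y' - y) / y') * (\<Sum>l\<in>{n<..N}. prob (D l)) \<le> h y' * (\<Sum>l\<in>{n<..N}. prob (D l))"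
        using hy' by (intro mult_right_mono sum_nonneg) auto
      also note 1
      also have "h (y + B) * prob A \<le> w * (C / y) * prob A"
        using hB by (intro mult_right_mono) auto
      finally have "w * ((y' - y) / y' * (\<Sum>l\<in>{n<..N}. prob (D l))) \<le> w * (C / y * prob A)"
        by (simp add: mult.assoc)
      then have "(y' - y) / y' * (\<Sum>l\<in>{n<..N}. prob (D l)) \<le> C / y * prob A"
        using w by (simp only: mult_le_cancel_left_pos)
      moreover have "y' > 0" "y' - y > 0" using yp y' B_ge by auto
      ultimately show ?thesis using yp by (simp add: field_simps)
    next
      case False
      then have "{n<..N} = {}" by auto
      moreover have "0 \<le> C * y' / (y * (y' - y)) * prob A"
        using y y' x1 C B_ge by (intro mult_nonneg_nonneg divide_nonneg_nonneg) auto
      ultimately show ?thesis by simp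
    qed
    then show ?thesis by (simp add: D_def)
  qed
  note main = this
  have m: "max x1 (2 * B) \<ge> 1" "max x1 (2 * B) \<ge> B" using B_ge by auto
  show thesis by (rule that[OF C m]) (rule main; blast)
qed

text \<open>Far out the drift is nonnegative, so
  \<open>(\<Delta> n \<omega>)^2 + B * \<Delta> n \<omega>\<close> has conditional mean at least
  \<open>v\<close>. For bounded steps it is nonpositive when the step goes down, at most
  \<open>2 * B * \<delta>\<close> when the step is below \<open>\<delta>\<close>, and at most
  \<open>2 * B^2\<close> always. Steps of size at least \<open>\<delta>\<close> must supply the rest
  of the mean.\<close>

lemma step_up:
  obtains \<delta> q x1 where "\<delta> > 0" "q > 0"
    "\<And>n A. A \<in> sets (F n) \<Longrightarrow> (\<And>\<omega>. \<omega> \<in> A \<Longrightarrow> X n \<omega> \<ge> x1) \<Longrightarrow> prob {\<omega> \<in> A. \<Delta> n \<omega> \<ge> \<delta>} \<ge> q * prob A"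
proof -
  \<comment> \<open>Then \<open>2 * B * \<delta>\<close> is \<open>v / 2\<close>, so small steps
    account for at most half of the mean.\<close>
  define \<delta> where "\<delta> = v / (4 * B)"
  have "prob {\<omega> \<in> A. \<Delta> n \<omega> \<ge> \<delta>} \<ge> v / (4 * B^2) * prob A"
    if A: "A \<in> sets (F n)" and AX: "\<And>\<omega>. \<omega> \<in> A \<Longrightarrow> X n \<omega> \<ge> max x0 1" for n A
  proof -
    define U where "U = {\<omega> \<in> A. \<Delta> n \<omega> \<ge> \<delta>}"
    have AM [measurable]: "A \<in> sets M" using A by (rule sets_F_M)
    have "U = A \<inter> {\<omega> \<in> space M. \<Delta> n \<omega> \<ge> \<delta>}" using sets.sets_into_space[OF AM] by (auto simp: U_def)
    then have UM [measurable]: "U \<in> sets M" by simp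
    have UA: "U \<subseteq> A" by (auto simp: U_def)
    have ind: "indicator A \<in> borel_measurable (F n)" using A by simp
    have i1: "integrable M (\<lambda>\<omega>. indicator A \<omega> * \<Delta> n \<omega>)" and i2: "integrable M (\<lambda>\<omega>. indicator A \<omega> * (\<Delta> n \<omega>)^2)"
      by (auto intro!: integrable_bdd_mult_jump[of _ 1])
    have c1: "integrable M (\<lambda>\<omega>. indicator A \<omega> * D1 n \<omega>)"
        "(\<integral>\<omega>. indicator A \<omega> * D1 n \<omega> \<partial>M) = (\<integral>\<omega>. indicator A \<omega> * \<Delta> n \<omega> \<partial>M)"
      by (rule sub.real_cond_exp_intg[OF i1 ind], measurable)+
    have c2: "integrable M (\<lambda>\<omega>. indicator A \<omega> * D2 n \<omega>)"
        "(\<integral>\<omega>. indicator A \<omega> * D2 n \<omega> \<partial>M) = (\<integral>\<omega>. indicator A \<omega> * (\<Delta> n \<omega>)^2 \<partial>M)"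
      by (rule sub.real_cond_exp_intg[OF i2 ind], measurable)+
    have "prob A * v \<le> (\<integral>\<omega>. indicator A \<omega> * D2 n \<omega> + B * (indicator A \<omega> * D1 n \<omega>) \<partial>M)"
      unfolding integral_indicator_mult[OF AM, symmetric]
    proof (rule integral_mono_AE)
      show "AE \<omega> in M. indicator A \<omega> * v \<le> indicator A \<omega> * D2 n \<omega> + B * (indicator A \<omega> * D1 n \<omega>)"
        using moments[of n]
      proof eventually_elim
        case (elim \<omega>)
        show ?case
        proof (cases "\<omega> \<in> A")
          case True
          then have "X n \<omega> \<ge> 1" "v \<le> D2 n \<omega>" "2 * X n \<omega> * D1 n \<omega> \<ge> \<epsilon> + D2 n \<omega>"
            using elim AX[OF True] by auto
          moreover from this have "D1 n \<omega> \<ge> 0"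
            using v_pos eps_pos by (smt (verit) mult_nonneg_nonpos)
          moreover from this have "0 \<le> B * D1 n \<omega>" using B_ge by (intro mult_nonneg_nonneg) auto
          ultimately show ?thesis using True by simp
        qed simp
      qed
    qed (use c1 c2 in \<open>auto intro!: Bochner_Integration.integrable_add indicator_integrable\<close>)
    also have "\<dots> = (\<integral>\<omega>. indicator A \<omega> * (\<Delta> n \<omega>)^2 + B * (indicator A \<omega> * \<Delta> n \<omega>) \<partial>M)"
      using c1 c2 i1 i2 by simp
    also have "\<dots> \<le> (\<integral>\<omega>. indicator U \<omega> * (2 * B^2) + indicator A \<omega> * (2 * B * \<delta>) \<partial>M)"
    proof (rule integral_mono_AE)
      show "AE \<omega> in M. indicator A \<omega> * (\<Delta> n \<omega>)^2 + B * (indicator A \<omega> * \<Delta> n \<omega>)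
          \<le> indicator U \<omega> * (2 * B^2) + indicator A \<omega> * (2 * B * \<delta>)"
        using jump_AE[of n] jump_sq_AE[of n]
      proof eventually_elim
        case (elim \<omega>)
        have \<delta>: "B * \<delta> > 0" using B_ge v_pos by (simp add: \<delta>_def)
        consider "\<omega> \<in> U" | "\<omega> \<in> A" "\<Delta> n \<omega> < \<delta>" | "\<omega> \<notin> A" "\<omega> \<notin> U"
          using UA unfolding U_def by fastforce
        then show ?case
        proof cases
          case 1
          have "B * \<Delta> n \<omega> \<le> B * B" using elim B_ge by (intro mult_left_mono) auto
          then show ?thesis using 1 UA elim(2) \<delta> by (auto simp: power2_eq_square)
        next
          case 2
          have "(\<Delta> n \<omega>)^2 \<le> B * \<bar>\<Delta> n \<omega>\<bar>"
            using elim mult_right_mono[of "\<bar>\<Delta> n \<omega>\<bar>" B "\<bar>\<Delta> n \<omega>\<bar>"] by (simp add: power2_eq_square abs_mult[symmetric])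
          moreover have "B * (\<bar>\<Delta> n \<omega>\<bar> + \<Delta> n \<omega>) \<le> B * (2 * \<delta>)"
            using 2 \<delta> B_ge by (intro mult_left_mono) (auto simp: zero_less_mult_iff)
          ultimately have "(\<Delta> n \<omega>)^2 + B * \<Delta> n \<omega> \<le> 2 * B * \<delta>" by (simp add: algebra_simps)
          then show ?thesis using 2 by (auto simp: indicator_def U_def)
        qed simp
      qed
    qed (use i1 i2 in auto)
    also have "\<dots> = prob U * (2 * B^2) + prob A * (2 * B * \<delta>)"
      by simp
    finally have "prob A * v \<le> prob U * (2 * B^2) + prob A * (v / 2)"
      using B_ge by (simp add: \<delta>_def)
    then have "prob A * v / 2 \<le> prob U * (2 * B^2)" by simp
    then show ?thesis using B_ge by (simp add: U_def field_simps)
  qed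
  note main = this
  have pos: "\<delta> > 0" "v / (4 * B^2) > 0" using v_pos B_ge by (auto simp: \<delta>_def)
  show thesis by (rule that[OF pos]) (rule main; blast)
qed

end

subsection \<open>First passage and local cuts\<close>

context drift_process
begin

lemma prob_disjoint_UN_le:
  fixes E :: "nat \<Rightarrow> 'a set"
  assumes "\<And>m. E m \<in> sets M" "disjoint_family E" "\<And>N. (\<Sum>m<N. prob (E m)) \<le> b"
  shows "prob (\<Union>m. E m) \<le> b"
proof -
  have "(\<lambda>m. prob (E m)) sums prob (\<Union>m. E m)"
    using assms by (intro finite_measure_UNION) auto
  then show ?thesis unfolding sums_def
    by (rule LIMSEQ_le_const2) (use assms(3) in auto)
qed

text \<open>Measurability, probability and growth are proved together, since the next step has to be
  taken from a set in \<open>F (n + K)\<close> on which the process is still above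
  \<open>x1\<close>.\<close>

lemma climb:
  assumes step: "\<And>n A. A \<in> sets (F n) \<Longrightarrow> (\<And>\<omega>. \<omega> \<in> A \<Longrightarrow> X n \<omega> \<ge> x1) \<Longrightarrow>
      prob {\<omega> \<in> A. \<Delta> n \<omega> \<ge> \<delta>} \<ge> q * prob A"
    and \<delta>: "\<delta> > 0" and q: "q > 0" and A: "A \<in> sets (F n)" "\<And>\<omega>. \<omega> \<in> A \<Longrightarrow> X n \<omega> \<ge> x1"
  shows "{\<omega> \<in> A. \<forall>i<K. \<Delta> (n + i) \<omega> \<ge> \<delta>} \<in> sets (F (n + K)) \<and>
    prob {\<omega> \<in> A. \<forall>i<K. \<Delta> (n + i) \<omega> \<ge> \<delta>} \<ge> q^K * prob A \<and>
    (\<forall>\<omega>\<in>{\<omega> \<in> A. \<forall>i<K. \<Delta> (n + i) \<omega> \<ge> \<delta>}. X (n + K) \<omega> \<ge> X n \<omega> + K * \<delta>)"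
proof (induction K)
  case (Suc K)
  define U where "U = {\<omega> \<in> A. \<forall>i<K. \<Delta> (n + i) \<omega> \<ge> \<delta>}"
  have U: "U \<in> sets (F (n + K))" "prob U \<ge> q^K * prob A" "\<And>\<omega>. \<omega> \<in> U \<Longrightarrow> X (n + K) \<omega> \<ge> X n \<omega> + K * \<delta>"
    using Suc.IH[folded U_def] by blast+
  have eq: "{\<omega> \<in> A. \<forall>i<Suc K. \<Delta> (n + i) \<omega> \<ge> \<delta>} = {\<omega> \<in> U. \<Delta> (n + K) \<omega> \<ge> \<delta>}"
    by (auto simp: U_def less_Suc_eq)
  have "X (n + K) \<omega> \<ge> x1" if "\<omega> \<in> U" for \<omega>
  proof -
    have "X n \<omega> \<ge> x1" using that A(2) by (auto simp: U_def)
    moreover have "real K * \<delta> \<ge> 0" using \<delta> by simp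
    ultimately show ?thesis using U(3)[OF that] by linarith
  qed
  then have "q * prob U \<le> prob {\<omega> \<in> U. \<Delta> (n + K) \<omega> \<ge> \<delta>}"
    by (intro step U(1))
  moreover have "q * (q^K * prob A) \<le> q * prob U" using q U(2) by (intro mult_left_mono) auto
  moreover have "{\<omega> \<in> U. \<Delta> (n + K) \<omega> \<ge> \<delta>} \<in> sets (F (n + Suc K))"
  proof -
    have [measurable]: "X (n + K) \<in> borel_measurable (F (n + Suc K))"
      "X (Suc (n + K)) \<in> borel_measurable (F (n + Suc K))"
      by (auto intro: X_measurable_F)
    have "{\<omega> \<in> space (F (n + Suc K)). \<Delta> (n + K) \<omega> \<ge> \<delta>} \<in> sets (F (n + Suc K))"
      by measurable
    then have "U \<inter> {\<omega> \<in> space (F (n + Suc K)). \<Delta> (n + K) \<omega> \<ge> \<delta>} \<in> sets (F (n + Suc K))"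
      using sets_F_lift[OF U(1), of "n + Suc K"] by (intro sets.Int) auto
    also have "U \<inter> {\<omega> \<in> space (F (n + Suc K)). \<Delta> (n + K) \<omega> \<ge> \<delta>} = {\<omega> \<in> U. \<Delta> (n + K) \<omega> \<ge> \<delta>}"
      using sets.sets_into_space[OF U(1)] by auto
    finally show ?thesis .
  qed
  moreover have "X (n + Suc K) \<omega> \<ge> X n \<omega> + Suc K * \<delta>" if "\<omega> \<in> U" "\<Delta> (n + K) \<omega> \<ge> \<delta>" for \<omega>
    using U(3)[OF that(1)] that(2) by (simp add: algebra_simps)
  ultimately show ?case unfolding eq by (simp add: mult.assoc)
qed (use A(1) in simp)

text \<open>The bound \<open>y + B\<close> costs only a null set for \<open>m > 0\<close>, since the increments are almost surely
  bounded by \<open>B\<close>.\<close>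

definition passage :: "real \<Rightarrow> nat \<Rightarrow> 'a set" where
  "passage y m = {\<omega> \<in> space M. (\<forall>l\<in>{..<m}. X l \<omega> \<in> {..<y}) \<and> X m \<omega> \<in> {y..y + B}}"

text \<open>Upper bounds are proved for this larger event, which forgets \<open>L\<close>,
  \<open>\<delta>\<close> and \<open>K\<close>; cut events inherit them by inclusion.\<close>

definition no_return :: "real \<Rightarrow> 'a set" where
  "no_return y = (\<Union>m. {\<omega> \<in> passage y m. \<forall>r\<in>{m..}. X r \<omega> \<in> {y..}})"

text \<open>The level that must not be crossed again is the deterministic \<open>y + L\<close> and not a point of the
  trajectory, so that the escape estimate applies with a constant level.\<close>

definition cut_event :: "real \<Rightarrow> real \<Rightarrow> nat \<Rightarrow> real \<Rightarrow> 'a set" where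
  "cut_event L \<delta> K y = (\<Union>m. {\<omega> \<in> {\<omega> \<in> passage y m. \<forall>i<K. \<Delta> (m + i) \<omega> \<ge> \<delta>}.
     \<forall>r\<in>{m + K..}. X r \<omega> \<in> {y + L..}})"

lemma passage_sets_F: "passage y m \<in> sets (F m)"
proof -
  have "passage y m = {\<omega> \<in> {\<omega> \<in> space (F m). \<forall>l\<in>{..<m}. X l \<omega> \<in> {..<y}}. \<forall>l\<in>{m}. X l \<omega> \<in> {y..y + B}}"
    by (auto simp: passage_def)
  also have "\<dots> \<in> sets (F m)" by (intro sets_F_all sets.top) auto
  finally show ?thesis .
qed

lemma passage_sets [measurable]: "passage y m \<in> sets M"
  using passage_sets_F by (rule sets_F_M)

lemma disjoint_passage: "disjoint_family (passage y)"
proof -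
  have "passage y m \<inter> passage y m' = {}" if "m < m'" for m m'
    using that by (force simp: passage_def)
  then show ?thesis unfolding disjoint_family_on_def
    by (metis Int_commute linorder_neqE_nat)
qed

lemma disjoint_in_passage: "(\<And>m. E m \<subseteq> passage y m) \<Longrightarrow> disjoint_family E"
  using disjoint_passage[of y] unfolding disjoint_family_on_def by blast

lemma no_return_sets [measurable]: "no_return y \<in> sets M"
  unfolding no_return_def by (intro sets.countable_UN image_subsetI sets_M_all) auto

text \<open>The measure \<open>N\<close> is left open because the zero-one argument needs the event
  in the sigma-algebra generated by all \<open>F n\<close>, which may be smaller than
  \<open>sets M\<close>.\<close>

lemma cut_event_sets_gen:
  assumes sp: "space N = space M" and [measurable]: "\<And>n. X n \<in> borel_measurable N"
  shows "cut_event L \<delta> K y \<in> sets N"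
proof -
  have "cut_event L \<delta> K y = {\<omega> \<in> space N. \<exists>m. (\<forall>l\<in>{..<m}. X l \<omega> \<in> {..<y}) \<and> X m \<omega> \<in> {y..y + B} \<and>
      (\<forall>i\<in>{..<K}. \<Delta> (m + i) \<omega> \<ge> \<delta>) \<and> (\<forall>r\<in>{m + K..}. X r \<omega> \<in> {y + L..})}"
    unfolding sp by (auto simp: cut_event_def passage_def)
  also have "\<dots> \<in> sets N" by measurable
  finally show ?thesis .
qed

lemma cut_event_sets [measurable]: "cut_event L \<delta> K y \<in> sets M"
  by (rule cut_event_sets_gen) auto

text \<open>On \<open>A\<close> the level \<open>y\<close> has not been reached by time
  \<open>n\<close>, so only passage times \<open>m > n\<close> contribute, and for these
  \<open>A\<close> belongs to \<open>F m\<close>. This is the purpose of the recurring hypothesis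
  that the process is below \<open>y\<close> up to time \<open>n\<close>.\<close>

lemma passage_Int_sets_F:
  assumes "A \<in> sets (F n)" "\<And>\<omega> l. \<omega> \<in> A \<Longrightarrow> l \<le> n \<Longrightarrow> X l \<omega> < y"
  shows "A \<inter> passage y m \<in> sets (F m)"
proof (cases "m \<le> n")
  case True
  then have "A \<inter> passage y m = {}" using assms(2) by (fastforce simp: passage_def)
  then show ?thesis by simp
next
  case False
  then show ?thesis using sets_F_lift[OF assms(1), of m] passage_sets_F by auto
qed

text \<open>The path is unbounded, so it enters; as it starts below \<open>y\<close>, the entrance
  is a jump from below \<open>y\<close> and overshoots by at most \<open>B\<close>.\<close>

lemma passage_AE:
  assumes "\<And>\<omega>. \<omega> \<in> A \<Longrightarrow> X 0 \<omega> < y"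
  shows "AE \<omega> in M. \<omega> \<in> A \<longrightarrow> (\<exists>m. \<omega> \<in> passage y m)"
  using jumps unbounded AE_space
proof eventually_elim
  case (elim \<omega>)
  show ?case
  proof
    assume "\<omega> \<in> A"
    then have X0: "X 0 \<omega> < y" using assms by auto
    define m where "m = (LEAST m. X m \<omega> \<ge> y)"
    obtain k where "X k \<omega> \<ge> y" using elim less_imp_le by blast
    then have m: "X m \<omega> \<ge> y" unfolding m_def by (rule LeastI)
    have lt: "X l \<omega> < y" if "l < m" for l
      using not_less_Least[OF that[unfolded m_def]] by auto
    obtain l where l: "m = Suc l" using m X0 by (cases m) auto
    have "X m \<omega> \<le> y + B" using elim(1) lt[of l] l by (smt (verit) lessI)
    then show "\<exists>m. \<omega> \<in> passage y m" using m lt elim by (auto simp: passage_def)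
  qed
qed

text \<open>The decomposition by passage time loses no mass, so an estimate valid at each passage
  time holds on \<open>A\<close> with the same constant.\<close>

lemma passage_sums:
  assumes A: "A \<in> sets M" "\<And>\<omega>. \<omega> \<in> A \<Longrightarrow> X 0 \<omega> < y"
  shows "(\<lambda>m. prob (A \<inter> passage y m)) sums prob A"
proof -
  note [measurable] = A(1)
  have "(\<lambda>m. prob (A \<inter> passage y m)) sums prob (\<Union>m. A \<inter> passage y m)"
    using disjoint_in_passage[of "\<lambda>m. A \<inter> passage y m"]
    by (intro finite_measure_UNION) (auto intro!: disjoint_in_passage)
  also have "prob (\<Union>m. A \<inter> passage y m) = prob A"
    by (rule finite_measure_eq_AE) (use passage_AE[of A y, OF A(2)] in auto)
  finally show ?thesis .
qed

text \<open>Passage, climb and escape are concatenated. Each estimate is conditional on the past at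
  the time when it starts, so the factors multiply without any Markov property.\<close>

lemma cut_event_lower:
  assumes L: "L \<ge> 0"
  obtains \<delta> K c x1 where "\<delta> > 0" "c > 0" "x1 \<ge> 1"
    "\<And>n A y. y \<ge> x1 \<Longrightarrow> A \<in> sets (F n) \<Longrightarrow> (\<And>\<omega> l. \<omega> \<in> A \<Longrightarrow> l \<le> n \<Longrightarrow> X l \<omega> < y) \<Longrightarrow>
      prob (A \<inter> cut_event L \<delta> K y) \<ge> c / y * prob A"
proof -
  obtain c x1 where c: "c > 0" and x1: "x1 \<ge> 1" and
    esc: "\<And>n A z. z \<ge> x1 \<Longrightarrow> A \<in> sets (F n) \<Longrightarrow> (\<And>\<omega>. \<omega> \<in> A \<Longrightarrow> X n \<omega> \<ge> z + 1) \<Longrightarrow>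
      prob {\<omega> \<in> A. \<forall>i\<in>{n..}. X i \<omega> \<in> {z..}} \<ge> c / z * prob A"
    by (rule escape_lower) blast
  obtain \<delta> q x2 where \<delta>: "\<delta> > 0" and q: "q > 0" and
    step: "\<And>n A. A \<in> sets (F n) \<Longrightarrow> (\<And>\<omega>. \<omega> \<in> A \<Longrightarrow> X n \<omega> \<ge> x2) \<Longrightarrow>
      prob {\<omega> \<in> A. \<Delta> n \<omega> \<ge> \<delta>} \<ge> q * prob A"
    by (rule step_up) blast
  \<comment> \<open>The \<open>+ 1\<close> is the clearance above the level \<open>y + L\<close>
    that \<open>escape_lower\<close> requires.\<close>
  obtain K :: nat where K: "K * \<delta> \<ge> L + 1"
    using real_arch_simple[of "(L + 1) / \<delta>"] \<delta> by (auto simp: field_simps)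
  define x3 where "x3 = max (max x1 x2) L"
  \<comment> \<open>\<open>q^K\<close> is the price of the climb, and the \<open>2\<close> comes
    from \<open>y + L \<le> 2 * y\<close>.\<close>
  define c' where "c' = c * q^K / 2"
  have main: "prob (A \<inter> cut_event L \<delta> K y) \<ge> c' / y * prob A"
    if y: "y \<ge> x3" and A: "A \<in> sets (F n)" and AX: "\<And>\<omega> l. \<omega> \<in> A \<Longrightarrow> l \<le> n \<Longrightarrow> X l \<omega> < y" for n A y
  proof -
    have [measurable]: "A \<in> sets M" using A by (rule sets_F_M)
    have y1: "y \<ge> 1" "y \<ge> x1" "y \<ge> x2" "y \<ge> L" using y x1 by (auto simp: x3_def)
    define U where "U m = {\<omega> \<in> A \<inter> passage y m. \<forall>i<K. \<Delta> (m + i) \<omega> \<ge> \<delta>}" for m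
    define E where "E m = {\<omega> \<in> U m. \<forall>r\<in>{m + K..}. X r \<omega> \<in> {y + L..}}" for m
    have Pm: "A \<inter> passage y m \<in> sets (F m)" for m
      using passage_Int_sets_F[OF A AX] by blast
    have U: "U m \<in> sets (F (m + K))" "q^K * prob (A \<inter> passage y m) \<le> prob (U m)"
      "\<And>\<omega>. \<omega> \<in> U m \<Longrightarrow> X (m + K) \<omega> \<ge> X m \<omega> + K * \<delta>" for m
    proof -
      have "U m \<in> sets (F (m + K)) \<and> prob (U m) \<ge> q^K * prob (A \<inter> passage y m) \<and>
          (\<forall>\<omega>\<in>U m. X (m + K) \<omega> \<ge> X m \<omega> + K * \<delta>)" for m
        unfolding U_def
      proof (rule climb[where ?x1.0 = x2, OF _ \<delta> q Pm])
        show "x2 \<le> X m \<omega>" if "\<omega> \<in> A \<inter> passage y m" for \<omega>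
          using that y1 by (auto simp: passage_def)
      qed (rule step; blast)
      then show "U m \<in> sets (F (m + K))" "q^K * prob (A \<inter> passage y m) \<le> prob (U m)"
        "\<And>\<omega>. \<omega> \<in> U m \<Longrightarrow> X (m + K) \<omega> \<ge> X m \<omega> + K * \<delta>" for m by auto
    qed
    have EM: "E m \<in> sets M" for m
      unfolding E_def using sets_F_M[OF U(1)] by (intro sets_M_all) auto
    have E: "c' / y * prob (A \<inter> passage y m) \<le> prob (E m)" for m
    proof -
      have "c / (y + L) * prob (U m) \<le> prob (E m)"
        unfolding E_def
      proof (rule esc[OF _ U(1)])
        fix \<omega> assume \<omega>: "\<omega> \<in> U m"
        then have "X m \<omega> \<ge> y" by (auto simp: U_def passage_def)
        then show "y + L + 1 \<le> X (m + K) \<omega>" using U(3)[OF \<omega>] K by linarith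
      qed (use y1 L in auto)
      moreover have "c / (y + L) * (q^K * prob (A \<inter> passage y m)) \<le> c / (y + L) * prob (U m)"
        using c y1 L U(2) by (intro mult_left_mono) auto
      moreover have "c / (2 * y) \<le> c / (y + L)" using c y1 L by (intro divide_left_mono) auto
      then have "c / (2 * y) * (q^K * prob (A \<inter> passage y m)) \<le> c / (y + L) * (q^K * prob (A \<inter> passage y m))"
        using q by (intro mult_right_mono) auto
      ultimately show ?thesis by (simp add: c'_def)
    qed
    have eq: "A \<inter> cut_event L \<delta> K y = (\<Union>m. E m)"
      unfolding cut_event_def E_def U_def by blast
    have "(\<lambda>m. prob (E m)) sums prob (\<Union>m. E m)"
      using EM by (intro finite_measure_UNION disjoint_in_passage) (auto simp: E_def U_def)
    moreover have "(\<lambda>m. c' / y * prob (A \<inter> passage y m)) sums (c' / y * prob A)"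
      using AX by (intro sums_mult passage_sums) auto
    ultimately show ?thesis unfolding eq by (rule sums_le[OF E, rotated])
  qed
  have "c' > 0" "x3 \<ge> 1" using c q x1 by (auto simp: c'_def x3_def)
  note pos = \<delta> this
  show thesis by (rule that[OF pos]) (rule main; blast)
qed

lemma cut_event_no_return:
  assumes "L \<ge> 0" "\<delta> > 0"
  shows "cut_event L \<delta> K y \<subseteq> no_return y"
proof
  fix \<omega> assume "\<omega> \<in> cut_event L \<delta> K y"
  then obtain m where m: "\<omega> \<in> passage y m" "\<And>i. i < K \<Longrightarrow> \<Delta> (m + i) \<omega> \<ge> \<delta>"
    "\<And>r. r \<ge> m + K \<Longrightarrow> X r \<omega> \<ge> y + L"
    by (auto simp: cut_event_def)
  have "X (m + i) \<omega> \<ge> y" if "i \<le> K" for i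
    using that
  proof (induction i)
    case (Suc i)
    then show ?case using m(2)[of i] assms by simp
  qed (use m(1) in \<open>auto simp: passage_def\<close>)
  then have "X r \<omega> \<ge> y" if "r \<ge> m" for r
    using m(3)[of r] assms(1) that by (cases "r \<ge> m + K") (force dest: le_Suc_ex)+
  then show "\<omega> \<in> no_return y" using m(1) by (auto simp: no_return_def)
qed

text \<open>An unbounded path that stays above \<open>y\<close> must cross to every higher level, so
  the crossing bound controls staying. For two levels, crossing from \<open>y\<close> to
  \<open>y'\<close> contributes \<open>C * y' / (y * (y' - y))\<close> and staying above
  \<open>y'\<close> afterwards contributes an order \<open>1 / y'\<close>; the factors
  \<open>y'\<close> cancel.\<close>

lemma no_return_upper:
  obtains C x1 where "C > 0" "x1 \<ge> 1"
    "\<And>n A y. y \<ge> x1 \<Longrightarrow> A \<in> sets (F n) \<Longrightarrow> (\<And>\<omega> l. \<omega> \<in> A \<Longrightarrow> l \<le> n \<Longrightarrow> X l \<omega> < y) \<Longrightarrow>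
      prob (A \<inter> no_return y) \<le> C / y * prob A"
    "\<And>n A y y'. y \<ge> x1 \<Longrightarrow> y' > y + B \<Longrightarrow> A \<in> sets (F n) \<Longrightarrow>
      (\<And>\<omega> l. \<omega> \<in> A \<Longrightarrow> l \<le> n \<Longrightarrow> X l \<omega> < y) \<Longrightarrow>
      prob (A \<inter> no_return y \<inter> no_return y') \<le> C / (y * (y' - y)) * prob A"
proof -
  obtain C x1 where C: "C > 0" and x1: "x1 \<ge> 1" "x1 \<ge> B" and
    cross: "\<And>n N A y y'. y \<ge> x1 \<Longrightarrow> y' > y + B \<Longrightarrow> A \<in> sets (F n) \<Longrightarrow>
      (\<And>\<omega>. \<omega> \<in> A \<Longrightarrow> y \<le> X n \<omega> \<and> X n \<omega> \<le> y + B) \<Longrightarrow>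
      (\<Sum>m\<in>{n<..N}. prob {\<omega> \<in> A. (\<forall>i\<in>{n..<m}. X i \<omega> \<in> {y..<y'}) \<and> X m \<omega> \<ge> y'})
        \<le> C * y' / (y * (y' - y)) * prob A"
    by (rule crossing_upper) blast
  \<comment> \<open>From \<open>crossing_upper\<close> with target \<open>3 * y\<close>, which
    exceeds \<open>y + B\<close> because \<open>B \<le> y\<close>: the factor is
    \<open>3 * y / (y * (2 * y))\<close>.\<close>
  define C2 where "C2 = 3 * C / 2"
  have C2: "C2 > 0" using C by (simp add: C2_def)
  have stay: "prob {\<omega> \<in> A. \<forall>r\<in>{n..}. X r \<omega> \<in> {y..}} \<le> C2 / y * prob A"
    if y: "y \<ge> x1" and A: "A \<in> sets (F n)" and AX: "\<And>\<omega>. \<omega> \<in> A \<Longrightarrow> y \<le> X n \<omega> \<and> X n \<omega> \<le> y + B" for n A y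
  proof -
    have [measurable]: "A \<in> sets M" using A by (rule sets_F_M)
    have y0: "y \<ge> 1" "y \<ge> B" using y x1 by auto
    define D where "D m = {\<omega> \<in> A. (\<forall>i\<in>{n..<m}. X i \<omega> \<in> {y..<3 * y}) \<and> X m \<omega> \<ge> 3 * y}" for m
    define E where "E m = (if m > n then D m else {})" for m
    have DM: "D m \<in> sets M" for m
    proof -
      have "D m = {\<omega> \<in> {\<omega> \<in> A. \<forall>i\<in>{n..<m}. X i \<omega> \<in> {y..<3 * y}}. \<forall>i\<in>{m}. X i \<omega> \<in> {3 * y..}}"
        by (auto simp: D_def)
      also have "\<dots> \<in> sets M" by (intro sets_M_all) auto
      finally show ?thesis .
    qed
    then have EM [measurable]: "E m \<in> sets M" for m by (simp add: E_def)
    have disj: "disjoint_family E"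
    proof -
      have "E m \<inter> E m' = {}" if "m < m'" for m m'
      proof -
        have False if "\<omega> \<in> E m" "\<omega> \<in> E m'" for \<omega>
        proof -
          have "X m \<omega> \<ge> 3 * y" "m > n" using that(1) by (auto simp: E_def D_def split: if_splits)
          moreover have "X m \<omega> < 3 * y"
            using that(2) \<open>m < m'\<close> \<open>m > n\<close> by (auto simp: E_def D_def split: if_splits)
          ultimately show False by simp
        qed
        then show ?thesis by blast
      qed
      then show ?thesis unfolding disjoint_family_on_def by (metis Int_commute linorder_neqE_nat)
    qed
    have "prob {\<omega> \<in> A. \<forall>r\<in>{n..}. X r \<omega> \<in> {y..}} \<le> prob (\<Union>m. E m)"
    proof (rule finite_measure_mono_AE)
      show "AE \<omega> in M. \<omega> \<in> {\<omega> \<in> A. \<forall>r\<in>{n..}. X r \<omega> \<in> {y..}} \<longrightarrow> \<omega> \<in> (\<Union>m. E m)"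
        using unbounded
      proof eventually_elim
        case (elim \<omega>)
        show ?case
        proof
          assume \<omega>: "\<omega> \<in> {\<omega> \<in> A. \<forall>r\<in>{n..}. X r \<omega> \<in> {y..}}"
          have "\<exists>k\<ge>n. X k \<omega> \<ge> 3 * y"
          proof (rule ccontr)
            assume *: "\<not> ?thesis"
            define b where "b = Max (insert (3 * y) ((\<lambda>k. X k \<omega>) ` {..n}))"
            obtain k where k: "X k \<omega> > b" using elim by blast
            have "X k \<omega> \<le> b"
            proof (cases "k \<le> n")
              case False
              then have "X k \<omega> \<le> 3 * y" using * by (meson linear)
              also have "\<dots> \<le> b" by (simp add: b_def)
              finally show ?thesis .
            next
              case True
              then show ?thesis unfolding b_def by (intro Max_ge) auto
            qed
            then show False using k by simp
          qed
          then obtain k where k: "k \<ge> n" "X k \<omega> \<ge> 3 * y" by blast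
          define m where "m = (LEAST m. m \<ge> n \<and> X m \<omega> \<ge> 3 * y)"
          have m: "m \<ge> n \<and> X m \<omega> \<ge> 3 * y" unfolding m_def by (rule LeastI[of _ k]) (use k in auto)
          have lt: "X i \<omega> < 3 * y" if "i \<ge> n" "i < m" for i
            using not_less_Least[OF that(2)[unfolded m_def]] that by auto
          have "X n \<omega> < 3 * y" using AX[of \<omega>] \<omega> y0 by auto
          then have "m \<noteq> n" using m by auto
          then have "\<omega> \<in> E m" using \<omega> m lt by (auto simp: E_def D_def)
          then show "\<omega> \<in> (\<Union>m. E m)" by blast
        qed
      qed
    qed measurable
    also have "\<dots> \<le> C2 / y * prob A"
    proof (rule prob_disjoint_UN_le[OF EM disj])
      fix N
      have "(\<Sum>m<N. prob (E m)) = (\<Sum>m\<in>{..<N} \<inter> {m. m > n}. prob (D m))"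
        by (simp add: E_def if_distrib sum.If_cases cong: if_cong)
      also have "\<dots> \<le> (\<Sum>m\<in>{n<..N}. prob (D m))" by (intro sum_mono2) auto
      also have "\<dots> \<le> C * (3 * y) / (y * (3 * y - y)) * prob A"
        unfolding D_def using y y0 by (intro cross[OF _ _ A AX]) auto
      also have "C * (3 * y) / (y * (3 * y - y)) = C2 / y" using y0 by (simp add: C2_def field_simps)
      finally show "(\<Sum>m<N. prob (E m)) \<le> C2 / y * prob A" .
    qed
    finally show ?thesis .
  qed
  have one: "prob (A \<inter> no_return y) \<le> C2 / y * prob A"
    if y: "y \<ge> x1" and A: "A \<in> sets (F n)" and AX: "\<And>\<omega> l. \<omega> \<in> A \<Longrightarrow> l \<le> n \<Longrightarrow> X l \<omega> < y" for n A y
  proof -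
    define E where "E m = {\<omega> \<in> A \<inter> passage y m. \<forall>r\<in>{m..}. X r \<omega> \<in> {y..}}" for m
    have eq: "A \<inter> no_return y = (\<Union>m. E m)" unfolding no_return_def E_def by blast
    have Pm: "A \<inter> passage y m \<in> sets (F m)" for m
      using passage_Int_sets_F[OF A AX] by blast
    have EM: "E m \<in> sets M" for m
      unfolding E_def using sets_F_M[OF Pm] by (intro sets_M_all) auto
    have "(\<lambda>m. prob (E m)) sums prob (\<Union>m. E m)"
      using EM by (intro finite_measure_UNION disjoint_in_passage) (auto simp: E_def)
    moreover have "(\<lambda>m. C2 / y * prob (A \<inter> passage y m)) sums (C2 / y * prob A)"
      using AX sets_F_M[OF A] by (intro sums_mult passage_sums) auto
    moreover have "prob (E m) \<le> C2 / y * prob (A \<inter> passage y m)" for m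
      unfolding E_def by (rule stay[OF y Pm]) (auto simp: passage_def)
    ultimately show ?thesis unfolding eq by (rule sums_le[rotated])
  qed
  have two: "prob (A \<inter> no_return y \<inter> no_return y') \<le> C * C2 / (y * (y' - y)) * prob A"
    if y: "y \<ge> x1" and y': "y' > y + B" and A: "A \<in> sets (F n)"
      and AX: "\<And>\<omega> l. \<omega> \<in> A \<Longrightarrow> l \<le> n \<Longrightarrow> X l \<omega> < y" for n A y y'
  proof -
    have y0: "y \<ge> 1" "y' \<ge> x1" "y' > 0" "y' - y > 0" using y y' x1 B_ge by auto
    have Pl: "A \<inter> passage y l \<in> sets (F l)" for l
      using passage_Int_sets_F[OF A AX] by blast
    define W where "W l = {\<omega> \<in> A \<inter> passage y l. \<forall>r\<in>{l..}. X r \<omega> \<in> {y..}} \<inter> no_return y'" for l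
    have eq: "A \<inter> no_return y \<inter> no_return y' = (\<Union>l. W l)" unfolding no_return_def W_def by blast
    have WM: "W l \<in> sets M" for l
      unfolding W_def by (intro sets.Int sets_M_all sets_F_M[OF Pl]) auto
    have W: "prob (W l) \<le> C * C2 / (y * (y' - y)) * prob (A \<inter> passage y l)" for l
    proof -
      define S where "S = {\<omega> \<in> A \<inter> passage y l. \<forall>r\<in>{l..}. X r \<omega> \<in> {y..}}"
      have SM: "S \<in> sets M" unfolding S_def by (intro sets_M_all sets_F_M[OF Pl]) auto
      define V where "V m = {\<omega> \<in> S \<inter> passage y' m. \<forall>r\<in>{m..}. X r \<omega> \<in> {y'..}}" for m
      \<comment> \<open>\<open>V m\<close> involves the whole future; \<open>E m\<close> is the part
        of it known at time \<open>m\<close>, to which \<open>stay\<close> can be applied.\<close>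
      define E where "E m = {\<omega> \<in> A \<inter> passage y l \<inter> passage y' m. \<forall>i\<in>{l..m}. X i \<omega> \<in> {y..}}" for m
      define D where "D m = {\<omega> \<in> A \<inter> passage y l. (\<forall>i\<in>{l..<m}. X i \<omega> \<in> {y..<y'}) \<and> X m \<omega> \<ge> y'}" for m
      have Weq: "W l = (\<Union>m. V m)" unfolding W_def V_def S_def no_return_def by blast
      have VM: "V m \<in> sets M" for m
        unfolding V_def using SM by (intro sets_M_all) auto
      have DM: "D m \<in> sets M" for m
      proof -
        have "D m = {\<omega> \<in> {\<omega> \<in> A \<inter> passage y l. \<forall>i\<in>{l..<m}. X i \<omega> \<in> {y..<y'}}. \<forall>i\<in>{m}. X i \<omega> \<in> {y'..}}"
          by (auto simp: D_def)
        also have "\<dots> \<in> sets M" by (intro sets_M_all sets_F_M[OF Pl]) auto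
        finally show ?thesis .
      qed
      \<comment> \<open>At the passage over \<open>y\<close> the position is at most
        \<open>y + B\<close>, still below \<open>y'\<close>, so \<open>y'\<close> is reached
        strictly later.\<close>
      have V0: "V m = {}" if "m \<le> l" for m
      proof -
        have False if "\<omega> \<in> V m" for \<omega>
        proof -
          have "X m \<omega> \<ge> y'" using that by (auto simp: V_def passage_def)
          moreover have "\<omega> \<in> passage y l" using that by (auto simp: V_def S_def)
          then have "m < l \<Longrightarrow> X m \<omega> < y" "X l \<omega> \<le> y + B" by (auto simp: passage_def)
          then have "X m \<omega> \<le> y + B"
            using \<open>m \<le> l\<close> B_ge by (cases "m = l") auto
          ultimately show False using y' by simp
        qed
        then show ?thesis by blast
      qed
      have V: "prob (V m) \<le> C2 / y' * prob (D m)" if "m > l" for m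
      proof -
        have EF: "E m \<in> sets (F m)"
          unfolding E_def using sets_F_lift[OF Pl, of l m] that passage_sets_F
          by (intro sets_F_all) auto
        have "prob (V m) \<le> prob {\<omega> \<in> E m. \<forall>r\<in>{m..}. X r \<omega> \<in> {y'..}}"
          using sets_F_M[OF EF] by (intro finite_measure_mono sets_M_all) (auto simp: V_def S_def E_def)
        also have "\<dots> \<le> C2 / y' * prob (E m)"
        proof (rule stay[OF y0(2) EF])
          fix \<omega> assume "\<omega> \<in> E m"
          then have "\<omega> \<in> passage y' m" by (simp add: E_def)
          then show "y' \<le> X m \<omega> \<and> X m \<omega> \<le> y' + B" by (simp add: passage_def)
        qed
        also have "\<dots> \<le> C2 / y' * prob (D m)"
        proof (intro mult_left_mono finite_measure_mono DM subsetI)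
          fix \<omega> assume \<omega>: "\<omega> \<in> E m"
          then have "\<omega> \<in> A \<inter> passage y l" "\<omega> \<in> passage y' m" "\<And>i. i \<in> {l..m} \<Longrightarrow> X i \<omega> \<ge> y"
            by (simp_all add: E_def)
          then show "\<omega> \<in> D m" by (simp add: D_def passage_def)
        qed (use C2 y0 in auto)
        finally show ?thesis .
      qed
      show ?thesis unfolding Weq
      proof (rule prob_disjoint_UN_le[OF VM])
        show "disjoint_family V" by (rule disjoint_in_passage) (auto simp: V_def)
        fix N
        have "(\<Sum>m<N. prob (V m)) = (\<Sum>m\<in>{..<N} \<inter> {l<..N}. prob (V m))"
        proof (intro sum.mono_neutral_right ballI)
          fix m assume "m \<in> {..<N} - {..<N} \<inter> {l<..N}"
          then have "m \<le> l" by auto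
          then show "prob (V m) = 0" using V0 by simp
        qed auto
        also have "\<dots> \<le> (\<Sum>m\<in>{l<..N}. prob (V m))" by (intro sum_mono2) auto
        also have "\<dots> \<le> (\<Sum>m\<in>{l<..N}. C2 / y' * prob (D m))" using V by (intro sum_mono) auto
        also have "\<dots> = C2 / y' * (\<Sum>m\<in>{l<..N}. prob (D m))" by (simp add: sum_distrib_left)
        also have "\<dots> \<le> C2 / y' * (C * y' / (y * (y' - y)) * prob (A \<inter> passage y l))"
          using C2 y0 unfolding D_def
          by (intro mult_left_mono cross[OF y y' Pl]) (auto simp: passage_def)
        also have "\<dots> = C * C2 / (y * (y' - y)) * prob (A \<inter> passage y l)"
          using y0 by (simp add: field_simps)
        finally show "(\<Sum>m<N. prob (V m)) \<le> C * C2 / (y * (y' - y)) * prob (A \<inter> passage y l)" .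
      qed
    qed
    have "(\<lambda>l. prob (W l)) sums prob (\<Union>l. W l)"
      using WM by (intro finite_measure_UNION disjoint_in_passage) (auto simp: W_def)
    moreover have "(\<lambda>l. C * C2 / (y * (y' - y)) * prob (A \<inter> passage y l)) sums (C * C2 / (y * (y' - y)) * prob A)"
      using AX sets_F_M[OF A] by (intro sums_mult passage_sums) auto
    ultimately show ?thesis unfolding eq by (rule sums_le[OF W])
  qed
  define C3 where "C3 = max C2 (C * C2)"
  have C3: "C3 > 0" using C2 by (simp add: C3_def)
  show thesis
  proof (rule that[OF C3 x1(1)])
    fix n A y assume y: "y \<ge> x1" and A: "A \<in> sets (F n)" and AX: "\<And>\<omega> l. \<omega> \<in> A \<Longrightarrow> l \<le> n \<Longrightarrow> X l \<omega> < y"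
    have "prob (A \<inter> no_return y) \<le> C2 / y * prob A" by (rule one[OF y A AX])
    also have "\<dots> \<le> C3 / y * prob A"
      using x1 y by (intro mult_right_mono divide_right_mono) (auto simp: C3_def)
    finally show "prob (A \<inter> no_return y) \<le> C3 / y * prob A" .
    fix y' assume y': "y' > y + B"
    have "prob (A \<inter> no_return y \<inter> no_return y') \<le> C * C2 / (y * (y' - y)) * prob A"
      by (rule two[OF y y' A AX])
    also have "\<dots> \<le> C3 / (y * (y' - y)) * prob A"
      using x1 y y' B_ge by (intro mult_right_mono divide_right_mono) (auto simp: C3_def)
    finally show "prob (A \<inter> no_return y \<inter> no_return y') \<le> C3 / (y * (y' - y)) * prob A" .
  qed
qed

end

subsection \<open>Second moments and the zero-one law\<close>

text \<open>Localised to \<open>A\<close> so that it can be used conditionally on the past.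
  Cauchy-Schwarz is replaced by the pointwise bound
  \<open>Z \<omega> \<le> t * (Z \<omega>)^2 + 1 / (4 * t)\<close> where \<open>Z\<close> is
  large.\<close>

lemma (in prob_space) paley_zygmund_on:
  fixes Z :: "'a \<Rightarrow> real"
  assumes A: "A \<in> sets M" and Z: "integrable M (\<lambda>\<omega>. indicator A \<omega> * Z \<omega>)"
    and Z2: "integrable M (\<lambda>\<omega>. indicator A \<omega> * (Z \<omega>)^2)" and Zm: "Z \<in> borel_measurable M"
    and a: "a > 0" and b: "b > 0"
    and first: "(\<integral>\<omega>. indicator A \<omega> * Z \<omega> \<partial>M) \<ge> a * prob A"
    and second: "(\<integral>\<omega>. indicator A \<omega> * (Z \<omega>)^2 \<partial>M) \<le> b * a^2 * prob A"
  shows "prob (A \<inter> {\<omega> \<in> space M. Z \<omega> \<ge> a / 2}) \<ge> prob A / (4 * b)"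
proof -
  note [measurable] = A Zm
  define U where "U = A \<inter> {\<omega> \<in> space M. Z \<omega> \<ge> a / 2}"
  have [measurable]: "U \<in> sets M" unfolding U_def by measurable
  \<comment> \<open>The second moment term then costs \<open>a * prob A / 4\<close> and the small
    values cost \<open>a * prob A / 2\<close>, which leaves a quarter of the mean for
    \<open>U\<close>.\<close>
  define t where "t = 1 / (4 * a * b)"
  have t: "t > 0" using a b by (simp add: t_def)
  have ind: "integrable M (\<lambda>\<omega>. indicator S \<omega> * (r::real))" if "S \<in> sets M" for S r
    using that by (intro integrable_mult_left) (auto simp: emeasure_eq_measure)
  have "(\<integral>\<omega>. indicator A \<omega> * Z \<omega> \<partial>M)
     \<le> (\<integral>\<omega>. indicator A \<omega> * (a / 2) + t * (indicator A \<omega> * (Z \<omega>)^2) + indicator U \<omega> * (a * b) \<partial>M)"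
  proof (rule integral_mono)
    show "indicator A \<omega> * Z \<omega> \<le> indicator A \<omega> * (a / 2) + t * (indicator A \<omega> * (Z \<omega>)^2) + indicator U \<omega> * (a * b)"
      if "\<omega> \<in> space M" for \<omega>
    proof (cases "\<omega> \<in> U")
      case True
      have "0 \<le> (2 * t * Z \<omega> - 1)^2 / (4 * t)" using t by simp
      also have "\<dots> = t * (Z \<omega>)^2 - Z \<omega> + 1 / (4 * t)"
        using t by (simp add: power2_eq_square field_simps)
      also have "1 / (4 * t) = a * b" using a b by (simp add: t_def)
      finally have "Z \<omega> \<le> t * (Z \<omega>)^2 + a * b" by simp
      moreover have "\<omega> \<in> A" using True by (simp add: U_def)
      ultimately show ?thesis using True a by simp
    next
      case False
      then show ?thesis using that t by (auto simp: U_def indicator_def intro: add_increasing2)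
    qed
  qed (intro Z Z2 ind Bochner_Integration.integrable_add integrable_mult_right; measurable)+
  also have "\<dots> = prob A * (a / 2) + t * (\<integral>\<omega>. indicator A \<omega> * (Z \<omega>)^2 \<partial>M) + prob U * (a * b)"
    using Z2 ind by (subst Bochner_Integration.integral_add Bochner_Integration.integral_add; auto)+
  also have "t * (\<integral>\<omega>. indicator A \<omega> * (Z \<omega>)^2 \<partial>M) \<le> t * (b * a^2 * prob A)"
    using second t by (intro mult_left_mono) auto
  also have "t * (b * a^2 * prob A) = prob A * (a / 4)"
    using a b by (simp add: t_def power2_eq_square)
  finally have "a * prob A \<le> prob A * (a / 2) + prob A * (a / 4) + prob U * (a * b)" using first by simp
  then have "a * (prob A / 4) \<le> a * (b * prob U)" by (simp add: algebra_simps)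
  then have "prob A / 4 \<le> b * prob U" using a by (simp only: mult_le_cancel_left_pos)
  then show ?thesis using b by (simp add: U_def field_simps)
qed

lemma harm_pair_sum:
  assumes "i \<ge> 1" "i \<le> m"
  shows "(\<Sum>j\<in>{i..m}. 1 / real (j - i + 1)) \<le> harm m"
proof -
  have "(\<Sum>j\<in>{i..m}. 1 / real (j - i + 1)) = (\<Sum>k\<in>{1..m - i + 1}. inverse (real k))"
    using assms by (intro sum.reindex_bij_witness[of _ "\<lambda>k. k + i - 1" "\<lambda>j. j - i + 1"]) (auto simp: field_simps)
  also have "\<dots> \<le> (\<Sum>k\<in>{1..m}. inverse (real k))"
    using assms by (intro sum_mono2) auto
  finally show ?thesis by (simp add: harm_def)
qed

section \<open>Zero-one law and infinitely many cut events\<close>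

context drift_process
begin

text \<open>Approximation in symmetric difference, by induction over the generated sigma-algebra:
  complements leave the symmetric difference unchanged, and a countable union is first cut down to a
  finite one by continuity from below.\<close>

lemma approx_by_F:
  assumes "E \<in> sigma_sets (space M) (\<Union>n. sets (F n))"
  shows "E \<in> sets M \<and> (\<forall>e>0. \<exists>n. \<exists>A\<in>sets (F n). prob ((E - A) \<union> (A - E)) < e)"
  using assms
proof (induction rule: sigma_sets.induct)
  case (Basic a)
  then obtain n where n: "a \<in> sets (F n)" by auto
  then show ?case using sets_F_M[OF n] by (auto intro!: exI[of _ n] bexI[of _ a])
next
  case Empty
  show ?case by (auto intro!: exI[of _ 0] bexI[of _ "{}"])
next
  case (Compl a)
  have "\<exists>n. \<exists>A\<in>sets (F n). prob ((space M - a - A) \<union> (A - (space M - a))) < e" if e: "e > 0" for e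
  proof -
    obtain n A where A: "A \<in> sets (F n)" "prob ((a - A) \<union> (A - a)) < e" using Compl e by blast
    have "a \<subseteq> space M" using Compl sets.sets_into_space by blast
    then have "(space M - a - (space M - A)) \<union> ((space M - A) - (space M - a)) = (a - A) \<union> (A - a)"
      using sets.sets_into_space[OF A(1)] by auto
    then show ?thesis using A sets.compl_sets[OF A(1)] by (intro exI[of _ n] bexI[of _ "space M - A"]) auto
  qed
  then show ?case using Compl by auto
next
  case (Union a)
  have aM [measurable]: "a i \<in> sets M" for i using Union by blast
  have fin: "\<exists>n. \<exists>A\<in>sets (F n). prob (((\<Union>i<k. a i) - A) \<union> (A - (\<Union>i<k. a i))) < e" if "e > 0" for k and e :: real
    using that
  proof (induction k arbitrary: e)
    case 0
    then show ?case by (auto intro!: exI[of _ 0] bexI[of _ "{}"])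
  next
    case (Suc k)
    obtain n A where A: "A \<in> sets (F n)" "prob (((\<Union>i<k. a i) - A) \<union> (A - (\<Union>i<k. a i))) < e / 2"
      using Suc.IH[of "e / 2"] Suc.prems by auto
    obtain n' A' where A': "A' \<in> sets (F n')" "prob ((a k - A') \<union> (A' - a k)) < e / 2"
      using Union.IH[of k] Suc.prems by (meson half_gt_zero)
    have [measurable]: "A \<in> sets M" "A' \<in> sets M" using A A' sets_F_M by auto
    have "prob (((\<Union>i<Suc k. a i) - (A \<union> A')) \<union> ((A \<union> A') - (\<Union>i<Suc k. a i)))
       \<le> prob ((((\<Union>i<k. a i) - A) \<union> (A - (\<Union>i<k. a i))) \<union> ((a k - A') \<union> (A' - a k)))"
      by (intro finite_measure_mono) (auto simp: lessThan_Suc)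
    also have "\<dots> \<le> prob (((\<Union>i<k. a i) - A) \<union> (A - (\<Union>i<k. a i))) + prob ((a k - A') \<union> (A' - a k))"
      by (intro measure_Un_le) auto
    also have "\<dots> < e" using A A' by simp
    finally have "prob (((\<Union>i<Suc k. a i) - (A \<union> A')) \<union> ((A \<union> A') - (\<Union>i<Suc k. a i))) < e" .
    moreover have "A \<union> A' \<in> sets (F (max n n'))"
      using sets_F_lift[OF A(1), of "max n n'"] sets_F_lift[OF A'(1), of "max n n'"] by auto
    ultimately show ?case by blast
  qed
  have "\<exists>n. \<exists>A\<in>sets (F n). prob (((\<Union>i. a i) - A) \<union> (A - (\<Union>i. a i))) < e" if e: "e > 0" for e
  proof -
    have "(\<lambda>k. prob (\<Union>i<k. a i)) \<longlonglongrightarrow> prob (\<Union>k. \<Union>i<k. a i)"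
      by (intro finite_Lim_measure_incseq) (auto simp: incseq_def intro: order_less_le_trans)
    also have "(\<Union>k. \<Union>i<k. a i) = (\<Union>i. a i)" by auto
    finally have "eventually (\<lambda>k. prob (\<Union>i<k. a i) > prob (\<Union>i. a i) - e / 2) sequentially"
      by (rule order_tendstoD) (use e in simp)
    then obtain k where k: "prob (\<Union>i<k. a i) > prob (\<Union>i. a i) - e / 2"
      by (auto simp: eventually_sequentially)
    obtain n A where A: "A \<in> sets (F n)" "prob (((\<Union>i<k. a i) - A) \<union> (A - (\<Union>i<k. a i))) < e / 2"
      using fin[of "e / 2" k] e by auto
    have [measurable]: "A \<in> sets M" using A sets_F_M by auto
    have "prob ((\<Union>i. a i) - (\<Union>i<k. a i)) = prob (\<Union>i. a i) - prob (\<Union>i<k. a i)"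
      by (intro finite_measure_Diff) auto
    moreover have "prob (((\<Union>i. a i) - A) \<union> (A - (\<Union>i. a i)))
       \<le> prob (((\<Union>i. a i) - (\<Union>i<k. a i)) \<union> (((\<Union>i<k. a i) - A) \<union> (A - (\<Union>i<k. a i))))"
      by (intro finite_measure_mono) auto
    moreover have "\<dots> \<le> prob ((\<Union>i. a i) - (\<Union>i<k. a i)) + prob (((\<Union>i<k. a i) - A) \<union> (A - (\<Union>i<k. a i)))"
      by (intro measure_Un_le) auto
    ultimately have "prob (((\<Union>i. a i) - A) \<union> (A - (\<Union>i. a i))) < e" using k A(2) by linarith
    then show ?thesis using A(1) by blast
  qed
  then show ?case by auto
qed

text \<open>Approximate the complement of \<open>E\<close> by a set \<open>A\<close> of some
  \<open>F n\<close>. Then \<open>A \<inter> E\<close> is small, so by hypothesis \<open>A\<close>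
  itself is small, and with it the complement of \<open>E\<close>.\<close>

lemma zero_one:
  assumes E: "E \<in> sigma_sets (space M) (\<Union>n. sets (F n))" and \<kappa>: "\<kappa> > 0"
    and ge: "\<And>n A. A \<in> sets (F n) \<Longrightarrow> prob (A \<inter> E) \<ge> \<kappa> * prob A"
  shows "AE \<omega> in M. \<omega> \<in> E"
proof -
  have EM [measurable]: "E \<in> sets M" using approx_by_F[OF E] by blast
  define p where "p = prob (space M - E)"
  have "p = 0"
  proof (rule ccontr)
    assume "p \<noteq> 0"
    then have p: "p > 0" using measure_nonneg[of M "space M - E"] by (simp add: p_def less_le)
    \<comment> \<open>Makes \<open>e / \<kappa> + e\<close> equal to \<open>p\<close>, so that the
      chain ends in \<open>p < p\<close>.\<close>
    define e where "e = p / (1 / \<kappa> + 1)"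
    have "e > 0" using p \<kappa> by (simp add: e_def add_pos_pos)
    moreover have "space M - E \<in> sigma_sets (space M) (\<Union>n. sets (F n))"
      using E by (rule sigma_sets.Compl)
    ultimately obtain n A where A: "A \<in> sets (F n)" "prob ((space M - E - A) \<union> (A - (space M - E))) < e"
      using approx_by_F by blast
    have [measurable]: "A \<in> sets M" using A sets_F_M by auto
    have "prob (A \<inter> E) \<le> prob ((space M - E - A) \<union> (A - (space M - E)))"
      by (intro finite_measure_mono) auto
    then have "\<kappa> * prob A < e" using ge[OF A(1)] A(2) by linarith
    then have 1: "prob A < e / \<kappa>" using \<kappa> by (simp add: field_simps)
    have "p \<le> prob (A \<union> ((space M - E - A) \<union> (A - (space M - E))))"
      unfolding p_def by (intro finite_measure_mono) auto
    also have "\<dots> \<le> prob A + prob ((space M - E - A) \<union> (A - (space M - E)))"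
      by (intro measure_Un_le) auto
    also have "\<dots> < e / \<kappa> + e" using 1 A(2) by simp
    also have "\<dots> = e * (1 / \<kappa> + 1)" by (simp add: algebra_simps)
    also have "\<dots> = p" using \<kappa> unfolding e_def by (simp add: add_pos_pos less_imp_neq[symmetric])
    finally show False by simp
  qed
  then have "prob E = 1" using prob_compl[of E] by (simp add: p_def)
  then show ?thesis by (simp add: prob_eq_1)
qed

text \<open>The point is that the bound is free of \<open>j\<^sub>0\<close>, which will move with
  the conditioning set. Since the harmonic series diverges, its head before \<open>j\<^sub>0\<close>
  is negligible for a long enough range of levels.\<close>

lemma many_cut_events:
  assumes G: "\<And>j. G j \<in> sets M"
    and c: "c > 0" and C: "C > 0" and A [measurable]: "A \<in> sets M" and j0: "j\<^sub>0 \<ge> 1"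
    and lower: "\<And>j. j \<ge> j\<^sub>0 \<Longrightarrow> prob (A \<inter> G j) \<ge> c / real j * prob A"
    and upper1: "\<And>j. j \<ge> j\<^sub>0 \<Longrightarrow> prob (A \<inter> G j) \<le> C / real j * prob A"
    and upper2: "\<And>i j. j\<^sub>0 \<le> i \<Longrightarrow> i < j \<Longrightarrow> prob (A \<inter> G i \<inter> G j) \<le> C / (real i * real (j - i)) * prob A"
  shows "prob (A \<inter> {\<omega> \<in> space M. infinite {j. \<omega> \<in> G j}}) \<ge> c^2 / (32 * C) * prob A"
proof -
  note [measurable] = G
  define U where "U r = {\<omega> \<in> space M. \<exists>m. (\<Sum>j<m. indicator (G j) \<omega>) \<ge> real r}" for r :: nat
  have UM [measurable]: "U r \<in> sets M" for r unfolding U_def by measurable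
  have r: "prob (A \<inter> U r) \<ge> c^2 / (32 * C) * prob A" for r
  proof -
    have "filterlim (\<lambda>m. harm m :: real) at_top sequentially" by (rule harm_at_top)
    \<comment> \<open>The first demand makes half of the mean of the count at least
      \<open>r\<close>; the second makes the sum from \<open>j\<^sub>0\<close> on at least half of
      \<open>harm m\<close>, so the second moment is comparable with the squared mean.\<close>
    then have "eventually (\<lambda>m. harm m \<ge> max (harm (j\<^sub>0 - 1) + 2 * real r / c + 1) (2 * harm (j\<^sub>0 - 1))) sequentially"
      unfolding filterlim_at_top by blast
    then obtain m where "harm m \<ge> max (harm (j\<^sub>0 - 1) + 2 * real r / c + 1) (2 * harm (j\<^sub>0 - 1))"
      unfolding eventually_sequentially by blast
    then have m: "harm m \<ge> harm (j\<^sub>0 - 1) + 2 * real r / c + 1" "harm m \<ge> 2 * (harm (j\<^sub>0 - 1) :: real)"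
      by simp_all
    define I where "I = {j\<^sub>0..m}"
    define S where "S = (\<Sum>j\<in>I. 1 / real j)"
    have "j\<^sub>0 \<le> m"
    proof (rule ccontr)
      assume "\<not> j\<^sub>0 \<le> m"
      then have "(harm m :: real) \<le> harm (j\<^sub>0 - 1)" by (intro harm_mono) auto
      then show False using m(1) c by (smt (verit) divide_nonneg_pos of_nat_0_le_iff)
    qed
    have "harm m = harm (j\<^sub>0 - 1) + S"
    proof -
      have "{1..m} = {1..j\<^sub>0 - 1} \<union> I" "{1..j\<^sub>0 - 1} \<inter> I = {}"
        using \<open>j\<^sub>0 \<le> m\<close> j0 by (auto simp: I_def)
      then show ?thesis unfolding harm_def S_def
        by (simp add: sum.union_disjoint I_def inverse_eq_divide)
    qed
    then have S: "S \<ge> 2 * real r / c + 1" "harm m \<le> 2 * S" using m by auto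
    then have S0: "S > 0" using c by (smt (verit) divide_nonneg_pos of_nat_0_le_iff)
    define Z where "Z \<omega> = (\<Sum>j\<in>I. indicator (G j) \<omega> :: real)" for \<omega>
    have Zm [measurable]: "Z \<in> borel_measurable M" unfolding Z_def by measurable
    have AZ: "indicator A \<omega> * Z \<omega> = (\<Sum>j\<in>I. indicator (A \<inter> G j) \<omega>)" for \<omega>
      by (simp add: Z_def sum_distrib_left indicator_inter_arith)
    have AZ2: "indicator A \<omega> * (Z \<omega>)^2 = (\<Sum>i\<in>I. \<Sum>j\<in>I. indicator (A \<inter> G i \<inter> G j) \<omega>)" for \<omega>
      unfolding Z_def power2_eq_square sum_product
      by (simp only: sum_distrib_left indicator_inter_arith mult.assoc)
    have int [simp]: "integrable M (\<lambda>\<omega>. indicat_real S \<omega>)" if "S \<in> sets M" for S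
      using that by simp
    have first: "(\<integral>\<omega>. indicator A \<omega> * Z \<omega> \<partial>M) \<ge> c * S * prob A"
    proof -
      have "c * S * prob A = (\<Sum>j\<in>I. c / real j * prob A)"
        by (simp add: S_def sum_distrib_left sum_distrib_right)
      also have "\<dots> \<le> (\<Sum>j\<in>I. prob (A \<inter> G j))" by (intro sum_mono lower) (auto simp: I_def)
      also have "\<dots> = (\<integral>\<omega>. indicator A \<omega> * Z \<omega> \<partial>M)"
        unfolding AZ by (subst Bochner_Integration.integral_sum) auto
      finally show ?thesis .
    qed
    \<comment> \<open>The factor \<open>2 / (j - i + 1)\<close> dominates \<open>1 / (j - i)\<close> and also covers the diagonal.\<close>
    define u where "u i j = (if i \<le> j then 2 / real i * (1 / real (j - i + 1)) else 0)" for i j :: nat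
    have pair: "prob (A \<inter> G i \<inter> G j) \<le> C * (u i j + u j i) * prob A" if "i \<in> I" "j \<in> I" for i j
    proof -
      have lt: "prob (A \<inter> G i \<inter> G j) \<le> C * u i j * prob A" if "i < j" "i \<in> I" for i j
      proof -
        have i: "i \<ge> 1" "i \<ge> j\<^sub>0" using that j0 by (auto simp: I_def)
        have "1 / (real i * real (j - i)) \<le> u i j"
        proof -
          define d where "d = real (j - i)"
          have "d \<ge> 1" using that by (simp add: d_def)
          then have "1 / d \<le> 2 * (1 / (d + 1))" by (simp add: field_simps)
          then have "1 / real i * (1 / d) \<le> 1 / real i * (2 * (1 / (d + 1)))"
            by (intro mult_left_mono) auto
          then show ?thesis using that by (simp add: u_def d_def add.commute)
        qed
        then have "C * (1 / (real i * real (j - i))) * prob A \<le> C * u i j * prob A"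
          using C by (intro mult_right_mono mult_left_mono) auto
        then show ?thesis using upper2[OF i(2) that(1)] by simp
      qed
      have u0: "u i j \<ge> 0" for i j by (simp add: u_def)
      consider "i < j" | "j < i" | "i = j" by linarith
      then show ?thesis
      proof cases
        case 1
        have "C * u i j * prob A \<le> C * (u i j + u j i) * prob A"
          using C u0 by (intro mult_right_mono mult_left_mono) auto
        then show ?thesis using lt[OF 1 that(1)] by simp
      next
        case 2
        have "C * u j i * prob A \<le> C * (u i j + u j i) * prob A"
          using C u0 by (intro mult_right_mono mult_left_mono) auto
        moreover have "A \<inter> G i \<inter> G j = A \<inter> G j \<inter> G i" by blast
        ultimately show ?thesis using lt[OF 2 that(2)] by simp
      next
        case 3
        have i: "i \<ge> 1" "i \<ge> j\<^sub>0" using that j0 by (auto simp: I_def)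
        have "1 / real i \<le> u i j + u j i" using 3 i by (simp add: u_def field_simps)
        then have "C * (1 / real i) * prob A \<le> C * (u i j + u j i) * prob A"
          using C by (intro mult_right_mono mult_left_mono) auto
        moreover have "A \<inter> G i \<inter> G j = A \<inter> G i" using 3 by blast
        ultimately show ?thesis using upper1[OF i(2)] by simp
      qed
    qed
    have usum: "(\<Sum>i\<in>I. \<Sum>j\<in>I. u i j) \<le> 2 * S * harm m"
    proof -
      have "(\<Sum>j\<in>I. u i j) \<le> 2 / real i * harm m" if i: "i \<in> I" for i
      proof -
        have "(\<Sum>j\<in>I. u i j) = (\<Sum>j\<in>{i..m}. u i j)"
          using i by (intro sum.mono_neutral_right) (auto simp: I_def u_def)
        also have "\<dots> = 2 / real i * (\<Sum>j\<in>{i..m}. 1 / real (j - i + 1))"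
          unfolding sum_distrib_left by (intro sum.cong) (auto simp: u_def)
        also have "\<dots> \<le> 2 / real i * harm m"
          using i j0 by (intro mult_left_mono harm_pair_sum) (auto simp: I_def)
        finally show ?thesis .
      qed
      then have "(\<Sum>i\<in>I. \<Sum>j\<in>I. u i j) \<le> (\<Sum>i\<in>I. 2 / real i * harm m)" by (rule sum_mono)
      also have "\<dots> = 2 * S * harm m" by (simp add: S_def sum_distrib_left sum_distrib_right)
      finally show ?thesis .
    qed
    have "(\<integral>\<omega>. indicator A \<omega> * (Z \<omega>)^2 \<partial>M) = (\<Sum>i\<in>I. \<Sum>j\<in>I. prob (A \<inter> G i \<inter> G j))"
      unfolding AZ2 by (subst Bochner_Integration.integral_sum; auto intro!: sum.cong)+
    also have "\<dots> \<le> (\<Sum>i\<in>I. \<Sum>j\<in>I. C * (u i j + u j i) * prob A)"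
      by (intro sum_mono pair)
    also have "\<dots> = C * ((\<Sum>i\<in>I. \<Sum>j\<in>I. u i j) + (\<Sum>i\<in>I. \<Sum>j\<in>I. u j i)) * prob A"
      by (simp add: sum_distrib_left sum_distrib_right sum.distrib distrib_left distrib_right)
    also have "(\<Sum>i\<in>I. \<Sum>j\<in>I. u j i) = (\<Sum>i\<in>I. \<Sum>j\<in>I. u i j)" by (rule sum.swap)
    also have "C * ((\<Sum>i\<in>I. \<Sum>j\<in>I. u i j) + (\<Sum>i\<in>I. \<Sum>j\<in>I. u i j)) * prob A \<le> C * (8 * S^2) * prob A"
    proof (intro mult_right_mono mult_left_mono)
      have "2 * S * harm m \<le> 2 * S * (2 * S)" using S S0 by (intro mult_left_mono) auto
      then show "(\<Sum>i\<in>I. \<Sum>j\<in>I. u i j) + (\<Sum>i\<in>I. \<Sum>j\<in>I. u i j) \<le> 8 * S^2"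
        using usum by (simp add: power2_eq_square)
    qed (use C in auto)
    \<comment> \<open>\<open>8 * C / c^2\<close> is the ratio of second moment to squared mean;
      Paley-Zygmund divides by four times this ratio.\<close>
    also have "\<dots> = 8 * C / c^2 * (c * S)^2 * prob A" using c by (simp add: power_mult_distrib)
    finally have second: "(\<integral>\<omega>. indicator A \<omega> * (Z \<omega>)^2 \<partial>M) \<le> 8 * C / c^2 * (c * S)^2 * prob A" .
    have "prob A / (4 * (8 * C / c^2)) \<le> prob (A \<inter> {\<omega> \<in> space M. Z \<omega> \<ge> c * S / 2})"
    proof (rule paley_zygmund_on[OF A _ _ Zm _ _ first second])
      show "integrable M (\<lambda>\<omega>. indicator A \<omega> * Z \<omega>)"
        unfolding AZ by (intro Bochner_Integration.integrable_sum int) auto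
      show "integrable M (\<lambda>\<omega>. indicator A \<omega> * (Z \<omega>)^2)"
        unfolding AZ2 by (intro Bochner_Integration.integrable_sum int) auto
    qed (use c C S0 in auto)
    also have "\<dots> \<le> prob (A \<inter> U r)"
    proof (rule finite_measure_mono)
      have "real r \<le> c * S / 2" using S(1) c by (simp add: field_simps)
      moreover have "Z \<omega> \<le> (\<Sum>j<Suc m. indicator (G j) \<omega>)" for \<omega>
        unfolding Z_def I_def by (intro sum_mono2) auto
      ultimately show "A \<inter> {\<omega> \<in> space M. Z \<omega> \<ge> c * S / 2} \<subseteq> A \<inter> U r"
        unfolding U_def by (blast intro: order.trans)
    qed measurable
    finally show ?thesis by (simp add: mult.commute)
  qed
  \<comment> \<open>The bound does not involve \<open>r\<close>, so it survives the decreasing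
    limit.\<close>
  have "(\<lambda>r. prob (A \<inter> U r)) \<longlonglongrightarrow> prob (\<Inter>r. A \<inter> U r)"
  proof (rule finite_Lim_measure_decseq)
    show "decseq (\<lambda>r. A \<inter> U r)"
      by (rule decseq_SucI) (auto simp: U_def; smt (verit))
  qed auto
  then have "c^2 / (32 * C) * prob A \<le> prob (\<Inter>r. A \<inter> U r)"
    by (rule LIMSEQ_le_const) (use r in auto)
  also have "\<dots> \<le> prob (A \<inter> {\<omega> \<in> space M. infinite {j. \<omega> \<in> G j}})"
  proof (rule finite_measure_mono)
    show "(\<Inter>r. A \<inter> U r) \<subseteq> A \<inter> {\<omega> \<in> space M. infinite {j. \<omega> \<in> G j}}"
    proof
      fix \<omega> assume \<omega>: "\<omega> \<in> (\<Inter>r. A \<inter> U r)"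
      have "infinite {j. \<omega> \<in> G j}"
      proof
        assume fin: "finite {j. \<omega> \<in> G j}"
        have "\<omega> \<in> U (Suc (card {j. \<omega> \<in> G j}))" using \<omega> by blast
        then obtain m where m: "(\<Sum>j<m. indicator (G j) \<omega>) \<ge> real (Suc (card {j. \<omega> \<in> G j}))"
          by (auto simp: U_def)
        have "(\<Sum>j<m. indicator (G j) \<omega> :: real) = real (card ({..<m} \<inter> {j. \<omega> \<in> G j}))"
          by (simp add: indicator_def sum.If_cases)
        also have "\<dots> \<le> real (card {j. \<omega> \<in> G j})"
          using fin by (intro of_nat_mono card_mono) auto
        finally show False using m by simp
      qed
      moreover have "\<omega> \<in> A" "\<omega> \<in> space M" using \<omega> by (auto simp: U_def)
      ultimately show "\<omega> \<in> A \<inter> {\<omega> \<in> space M. infinite {j. \<omega> \<in> G j}}" by blast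
    qed
    show "A \<inter> {\<omega> \<in> space M. infinite {j. \<omega> \<in> G j}} \<in> sets M"
      unfolding infinite_nat_iff_unbounded_le mem_Collect_eq by measurable
  qed
  finally show ?thesis .
qed

text \<open>The spacing \<open>L\<close> exceeds \<open>B\<close>, as the pair bound requires. The
  past is first assumed to lie below some \<open>R\<close>, so that all levels from \<open>R\<close>
  on are still ahead.\<close>

lemma cut_events_io:
  assumes L: "L \<ge> 2 * B"
  obtains \<delta> K c j\<^sub>1 where "\<delta> > 0" "c > 0"
    "AE \<omega> in M. infinite {j. \<omega> \<in> cut_event L \<delta> K (real j * L)}"
    "\<And>j. j \<ge> j\<^sub>1 \<Longrightarrow> prob (cut_event L \<delta> K (real j * L)) \<ge> c / real j"
proof -
  have L0: "L \<ge> 0" "L > 0" "L > B" using L B_ge by auto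
  obtain \<delta> K c x1 where \<delta>: "\<delta> > 0" and c: "c > 0" and x1: "x1 \<ge> 1" and
    low: "\<And>n A y. y \<ge> x1 \<Longrightarrow> A \<in> sets (F n) \<Longrightarrow> (\<And>\<omega> l. \<omega> \<in> A \<Longrightarrow> l \<le> n \<Longrightarrow> X l \<omega> < y) \<Longrightarrow>
      prob (A \<inter> cut_event L \<delta> K y) \<ge> c / y * prob A"
    by (rule cut_event_lower[OF L0(1)]) blast
  obtain C x2 where C: "C > 0" and x2: "x2 \<ge> 1" and
    up1: "\<And>n A y. y \<ge> x2 \<Longrightarrow> A \<in> sets (F n) \<Longrightarrow> (\<And>\<omega> l. \<omega> \<in> A \<Longrightarrow> l \<le> n \<Longrightarrow> X l \<omega> < y) \<Longrightarrow>
      prob (A \<inter> no_return y) \<le> C / y * prob A" and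
    up2: "\<And>n A y y'. y \<ge> x2 \<Longrightarrow> y' > y + B \<Longrightarrow> A \<in> sets (F n) \<Longrightarrow>
      (\<And>\<omega> l. \<omega> \<in> A \<Longrightarrow> l \<le> n \<Longrightarrow> X l \<omega> < y) \<Longrightarrow>
      prob (A \<inter> no_return y \<inter> no_return y') \<le> C / (y * (y' - y)) * prob A"
    by (rule no_return_upper) blast
  define G where "G j = cut_event L \<delta> K (real j * L)" for j
  have GM [measurable]: "G j \<in> sets M" for j by (simp add: G_def)
  have GH: "G j \<subseteq> no_return (real j * L)" for j
    unfolding G_def by (rule cut_event_no_return[OF L0(1) \<delta>])
  define C' where "C' = max (C / L) (C / L^2)"
  have C': "C' > 0" using C L0 by (simp add: C'_def less_max_iff_disj)
  define \<kappa> where "\<kappa> = (c / L)^2 / (32 * C')"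
  have \<kappa>: "\<kappa> > 0" using c L0 C' by (simp add: \<kappa>_def)
  define E where "E = {\<omega> \<in> space M. infinite {j. \<omega> \<in> G j}}"
  have bounded: "prob (A \<inter> E) \<ge> \<kappa> * prob A"
    if A: "A \<in> sets (F n)" and AX: "\<And>\<omega> l. \<omega> \<in> A \<Longrightarrow> l \<le> n \<Longrightarrow> X l \<omega> < R" for n A R
  proof -
    obtain j\<^sub>0 :: nat where j0: "max (max x1 x2) R / L + 1 \<le> j\<^sub>0" using real_arch_simple by blast
    have "0 \<le> max (max x1 x2) R / L" using x1 L0 by simp
    then have "j\<^sub>0 \<ge> 1" using j0 by linarith
    have jL: "real j * L \<ge> x1" "real j * L \<ge> x2" "real j * L \<ge> R" "j \<ge> 1" if "j \<ge> j\<^sub>0" for j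
    proof -
      have "max (max x1 x2) R / L \<le> real j" using j0 that by linarith
      then have "max (max x1 x2) R \<le> real j * L" using L0 by (simp add: field_simps)
      then show "real j * L \<ge> x1" "real j * L \<ge> x2" "real j * L \<ge> R" by auto
      show "j \<ge> 1" using that \<open>j\<^sub>0 \<ge> 1\<close> by simp
    qed
    have AL: "X l \<omega> < real j * L" if "j \<ge> j\<^sub>0" "\<omega> \<in> A" "l \<le> n" for j \<omega> l
      using AX[OF that(2,3)] jL(3)[OF that(1)] by simp
    note AM = sets_F_M[OF A]
    show ?thesis unfolding E_def \<kappa>_def
    proof (rule many_cut_events[OF GM _ C' AM \<open>j\<^sub>0 \<ge> 1\<close>])
      show "c / L > 0" using c L0 by simp
      show "c / L / real j * prob A \<le> prob (A \<inter> G j)" if "j \<ge> j\<^sub>0" for j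
        using low[OF jL(1)[OF that] A AL[OF that]] by (simp add: G_def mult.commute)
      show "prob (A \<inter> G j) \<le> C' / real j * prob A" if "j \<ge> j\<^sub>0" for j
      proof -
        have "prob (A \<inter> G j) \<le> prob (A \<inter> no_return (real j * L))"
          using GH AM by (intro finite_measure_mono) auto
        also have "\<dots> \<le> C / (real j * L) * prob A" by (rule up1[OF jL(2)[OF that] A AL[OF that]])
        also have "C / (real j * L) = C / L / real j" by simp
        also have "C / L / real j * prob A \<le> C' / real j * prob A"
          by (intro mult_right_mono divide_right_mono) (auto simp: C'_def)
        finally show ?thesis .
      qed
      show "prob (A \<inter> G i \<inter> G j) \<le> C' / (real i * real (j - i)) * prob A" if "j\<^sub>0 \<le> i" "i < j" for i j
      proof -
        have d: "real j * L - real i * L = real (j - i) * L"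
          using that by (simp add: of_nat_diff algebra_simps)
        have "1 * L \<le> real (j - i) * L" using that L0 by (intro mult_right_mono) auto
        then have gap: "real j * L > real i * L + B" using d L0 by linarith
        have "prob (A \<inter> G i \<inter> G j) \<le> prob (A \<inter> no_return (real i * L) \<inter> no_return (real j * L))"
          using GH AM by (intro finite_measure_mono sets.Int no_return_sets) auto
        also have "\<dots> \<le> C / (real i * L * (real j * L - real i * L)) * prob A"
          by (rule up2[OF jL(2)[OF that(1)] gap A AL[OF that(1)]])
        also have "C / (real i * L * (real j * L - real i * L)) = C / L^2 / (real i * real (j - i))"
          unfolding d by (simp add: power2_eq_square mult_ac)
        also have "C / L^2 / (real i * real (j - i)) * prob A \<le> C' / (real i * real (j - i)) * prob A"
          by (intro mult_right_mono divide_right_mono) (auto simp: C'_def)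
        finally show ?thesis .
      qed
    qed
  qed
  have EM [measurable]: "E \<in> sets M"
    unfolding E_def infinite_nat_iff_unbounded_le mem_Collect_eq by measurable
  \<comment> \<open>\<open>\<kappa>\<close> does not involve \<open>R\<close>, so the restriction on
    the past is removed by letting \<open>R\<close> grow.\<close>
  have all: "prob (A \<inter> E) \<ge> \<kappa> * prob A" if A: "A \<in> sets (F n)" for n A
  proof -
    define A' where "A' R = {\<omega> \<in> A. \<forall>l\<in>{..n}. X l \<omega> \<in> {..<real R}}" for R :: nat
    have A': "A' R \<in> sets (F n)" for R unfolding A'_def by (intro sets_F_all A) auto
    have [measurable]: "A \<in> sets M" "A' R \<in> sets M" for R using A A' sets_F_M by auto
    have "\<kappa> * prob (A' R) \<le> prob (A \<inter> E)" for R
    proof -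
      have "\<kappa> * prob (A' R) \<le> prob (A' R \<inter> E)"
        by (rule bounded[OF A', of R "real R"]) (auto simp: A'_def)
      also have "\<dots> \<le> prob (A \<inter> E)" by (intro finite_measure_mono) (auto simp: A'_def)
      finally show ?thesis .
    qed
    moreover have "(\<lambda>R. \<kappa> * prob (A' R)) \<longlonglongrightarrow> \<kappa> * prob (\<Union>R. A' R)"
      by (intro tendsto_mult_left finite_Lim_measure_incseq)
         (auto intro!: incseq_SucI simp: A'_def intro: less_trans)
    moreover have "(\<Union>R. A' R) = A"
    proof -
      have "\<exists>R. \<omega> \<in> A' R" if "\<omega> \<in> A" for \<omega>
      proof -
        obtain R :: nat where R: "Max ((\<lambda>l. X l \<omega>) ` {..n}) < R" using reals_Archimedean2 by blast
        have "X l \<omega> < R" if "l \<le> n" for l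
          using that by (intro le_less_trans[OF Max_ge R]) auto
        then show ?thesis using \<open>\<omega> \<in> A\<close> by (auto simp: A'_def)
      qed
      then show ?thesis by (auto simp: A'_def)
    qed
    ultimately show ?thesis by (metis LIMSEQ_le_const2)
  qed
  have Esig: "E \<in> sigma_sets (space M) (\<Union>n. sets (F n))"
  proof -
    define N where "N = sigma (space M) (\<Union>n. sets (F n))"
    have Pow: "(\<Union>n. sets (F n)) \<subseteq> Pow (space M)" using sets.space_closed space_F by blast
    have sN: "space N = space M" "sets N = sigma_sets (space M) (\<Union>n. sets (F n))"
      using Pow by (auto simp: N_def)
    have "X n \<in> borel_measurable N" for n
    proof (rule measurableI)
      fix Q :: "real set" assume "Q \<in> sets borel"
      then have "X n -` Q \<inter> space (F n) \<in> sets (F n)" by (rule measurable_sets[OF adapted])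
      then show "X n -` Q \<inter> space N \<in> sets N" unfolding sN by (auto intro: sigma_sets.Basic)
    qed auto
    then have [measurable]: "G j \<in> sets N" for j
      unfolding G_def by (intro cut_event_sets_gen sN)
    have "{\<omega> \<in> space N. infinite {j. \<omega> \<in> G j}} \<in> sets N"
      unfolding infinite_nat_iff_unbounded_le mem_Collect_eq by measurable
    then show ?thesis by (simp add: sN E_def)
  qed
  have "AE \<omega> in M. \<omega> \<in> E" by (rule zero_one[OF Esig \<kappa> all])
  then have io: "AE \<omega> in M. infinite {j. \<omega> \<in> cut_event L \<delta> K (real j * L)}"
    by eventually_elim (simp add: E_def G_def)
  \<comment> \<open>The unconditional bound on single levels needs a start below the level. As
    \<open>X 0\<close> may be unbounded, a start below some \<open>R\<close> is used that has
    probability above \<open>1/2\<close>.\<close>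
  have "(\<lambda>R::nat. prob {\<omega> \<in> space M. X 0 \<omega> < real R}) \<longlonglongrightarrow> prob (\<Union>R::nat. {\<omega> \<in> space M. X 0 \<omega> < real R})"
    by (intro finite_Lim_measure_incseq) (auto intro!: incseq_SucI)
  also have "(\<Union>R::nat. {\<omega> \<in> space M. X 0 \<omega> < real R}) = space M"
    using reals_Archimedean2 by auto
  finally have "eventually (\<lambda>R::nat. prob {\<omega> \<in> space M. X 0 \<omega> < real R} > 1 / 2) sequentially"
    by (rule order_tendstoD) (simp add: prob_space)
  then obtain R :: nat where R: "prob {\<omega> \<in> space M. X 0 \<omega> < real R} > 1 / 2"
    by (auto simp: eventually_sequentially)
  define A where "A = {\<omega> \<in> space M. X 0 \<omega> < real R}"
  have A: "A \<in> sets (F 0)"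
  proof -
    have "{\<omega> \<in> space (F 0). X 0 \<omega> < real R} \<in> sets (F 0)" using adapted[of 0] by measurable
    then show ?thesis by (simp add: A_def)
  qed
  obtain j\<^sub>1 :: nat where j1: "max x1 R / L \<le> j\<^sub>1" using real_arch_simple by blast
  have low': "prob (cut_event L \<delta> K (real j * L)) \<ge> c / (2 * L) / real j" if "j \<ge> j\<^sub>1" for j
  proof -
    have "max x1 R / L \<le> real j" using j1 that by linarith
    then have jL: "x1 \<le> real j * L" "R \<le> real j * L" using L0 by (auto simp: field_simps)
    have "c / (real j * L) * prob A \<le> prob (A \<inter> cut_event L \<delta> K (real j * L))"
      using jL(2) by (intro low[OF jL(1) A]) (auto simp: A_def)
    also have "\<dots> \<le> prob (cut_event L \<delta> K (real j * L))"
      by (intro finite_measure_mono) auto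
    finally have "c / (real j * L) * prob A \<le> prob (cut_event L \<delta> K (real j * L))" .
    moreover have "c / (real j * L) * (1 / 2) \<le> c / (real j * L) * prob A"
      using R c L0 by (intro mult_left_mono) (auto simp: A_def)
    ultimately show ?thesis by (simp add: mult_ac)
  qed
  have "c / (2 * L) > 0" using c L0 by simp
  note pos = \<delta> this
  show thesis by (rule that[OF pos io]) (rule low')
qed

end

subsection \<open>Cut intervals and strong cutpoints\<close>

lemma strong_cutpoints_eq_image:
  fixes x :: "nat \<Rightarrow> real"
  assumes "\<And>n. x n \<ge> 0"
  shows "strong_cutpoints x = x ` {n. (\<forall>m<n. x m < x n) \<and> (\<forall>m>n. x m > x n)}"
  using assms by (auto simp: strong_cutpoints_def strong_cutpoint_def)

text \<open>In terms of time indices the event is a countable combination of comparisons between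
  coordinates, from which its measurability can be read off.\<close>

lemma infinite_strong_cutpoints_iff:
  fixes x :: "nat \<Rightarrow> real"
  assumes "\<And>n. x n \<ge> 0"
  shows "infinite (strong_cutpoints x) \<longleftrightarrow> infinite {n. (\<forall>m<n. x m < x n) \<and> (\<forall>m>n. x m > x n)}"
proof -
  have "inj_on x {n. (\<forall>m<n. x m < x n) \<and> (\<forall>m>n. x m > x n)}"
    by (rule inj_onI) (metis (mono_tags, lifting) less_irrefl linorder_neqE_nat mem_Collect_eq)
  then show ?thesis unfolding strong_cutpoints_eq_image[OF assms] by (simp add: finite_image_iff)
qed

definition level :: "real \<Rightarrow> nat \<Rightarrow> real set" where
  "level L j = {real j * L<..<real j * L + L}"

lemma disjoint_levels:
  assumes "L > 0" "i \<noteq> j"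
  shows "level L i \<inter> level L j = {}"
proof -
  have "level L i \<inter> level L j = {}" if "i < j" for i j :: nat
  proof -
    have "(real i + 1) * L \<le> real j * L" using that assms by (intro mult_right_mono) auto
    then show ?thesis by (auto simp: level_def algebra_simps)
  qed
  then show ?thesis using assms(2) by (metis Int_commute linorder_neqE_nat)
qed

text \<open>Turns a count of levels into a count of strong cutpoints: for \<open>k \<ge> 1\<close>
  each such level contains a visited point, and disjoint levels give distinct points.\<close>

lemma strong_cutpoints_at_levels:
  assumes L: "L > 0" and k: "k \<ge> 1"
    and J: "\<And>j. j \<in> J \<Longrightarrow> cut_interval h k x (level L j)"
  obtains f where "inj_on f J" "\<And>j. j \<in> J \<Longrightarrow> f j \<in> level L j \<inter> strong_cutpoints x"
proof -
  define f where "f j = (SOME y. y \<in> level L j \<inter> strong_cutpoints x)" for j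
  have f: "f j \<in> level L j \<inter> strong_cutpoints x" if "j \<in> J" for j
  proof -
    have ci: "cut_interval h k x (level L j)" using J that .
    have int: "interior (level L j) = level L j" by (simp add: level_def interior_open)
    have "range x \<inter> level L j \<noteq> {}"
      using ci k unfolding cut_interval_def int by (metis card.empty finite.emptyI not_one_le_zero order.trans)
    then obtain y where "y \<in> range x \<inter> level L j" by blast
    then have "y \<in> level L j \<inter> strong_cutpoints x"
      using ci unfolding cut_interval_def int strong_cutpoints_def by blast
    then show ?thesis unfolding f_def by (rule someI)
  qed
  have "inj_on f J"
  proof (rule inj_onI, rule ccontr)
    fix i j assume ij: "i \<in> J" "j \<in> J" "f i = f j" "i \<noteq> j"
    then have "f i \<in> level L i \<inter> level L j" using f[OF ij(1)] f[OF ij(2)] by auto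
    then show False using disjoint_levels[OF L ij(4)] by blast
  qed
  then show thesis using f by (rule that)
qed

section \<open>From cut events to cut intervals, strong cutpoints and their expected number\<close>

context drift_process
begin

text \<open>The interval can be visited only during the climb: earlier the path is below
  \<open>y\<close>, afterwards it is at or above \<open>y + L\<close>. The climb is strictly
  increasing, so every visited interior point is a strong cutpoint. The length leaves room for
  \<open>k\<close> jumps after an overshoot of at most \<open>B\<close>.\<close>

lemma cut_interval_of_cut_event:
  assumes \<omega>: "\<omega> \<in> cut_event L \<delta> K y" and J: "\<And>n. \<bar>\<Delta> n \<omega>\<bar> \<le> B"
    and \<delta>: "\<delta> > 0" and y: "y \<ge> 0" and L: "L \<ge> (real k + 2) * B" "L \<ge> h"
  shows "cut_interval h k (\<lambda>n. X n \<omega>) {y<..<y + L}"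
proof -
  obtain m where m: "\<omega> \<in> passage y m" "\<And>i. i < K \<Longrightarrow> \<Delta> (m + i) \<omega> \<ge> \<delta>"
    "\<And>r. r \<ge> m + K \<Longrightarrow> X r \<omega> \<ge> y + L"
    using \<omega> by (auto simp: cut_event_def)
  have before: "\<And>l. l < m \<Longrightarrow> X l \<omega> < y" and Xm: "y \<le> X m \<omega>" "X m \<omega> \<le> y + B"
    using m(1) by (auto simp: passage_def)
  have L0: "L > 0"
  proof -
    have "(real k + 2) * B > 0" using B_ge by (intro mult_pos_pos) auto
    then show ?thesis using L by linarith
  qed
  have incr: "X (m + i) \<omega> < X (m + j) \<omega>" if "i < j" "j \<le> K" for i j
    using that
  proof (induction j)
    case (Suc j)
    have "X (m + j) \<omega> < X (m + Suc j) \<omega>" using m(2)[of j] Suc.prems \<delta> by simp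
    moreover have "X (m + i) \<omega> \<le> X (m + j) \<omega>"
      using Suc by (cases "i = j") auto
    ultimately show ?case by simp
  qed simp
  have growth: "X (m + i) \<omega> \<le> y + (real i + 1) * B" for i
  proof (induction i)
    case (Suc i)
    have "X (m + Suc i) \<omega> - X (m + i) \<omega> \<le> B"
      using order.trans[OF abs_ge_self J[of "m + i"]] by simp
    moreover have "(real (Suc i) + 1) * B = (real i + 1) * B + B" by (simp add: distrib_right)
    ultimately show ?case using Suc.IH by linarith
  qed (use Xm in simp)
  have below: "X (m + i) \<omega> < y + L" if "i \<le> k" for i
  proof -
    have "(real i + 1) * B < (real k + 2) * B"
      using that B_ge by (intro mult_strict_right_mono) auto
    then show ?thesis using growth[of i] L by linarith
  qed
  \<comment> \<open>With \<open>k\<close> steps or fewer the climb could not have reached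
    \<open>y + L\<close>.\<close>
  have kK: "k < K"
  proof (rule ccontr)
    assume "\<not> k < K"
    then have "X (m + K) \<omega> < y + L" by (intro below) simp
    then show False using m(3)[of "m + K"] by simp
  qed
  have "card (range (\<lambda>n. X n \<omega>) \<inter> {y<..<y + L}) \<ge> k \<or> infinite (range (\<lambda>n. X n \<omega>) \<inter> {y<..<y + L})"
  proof (rule disjCI)
    assume "\<not> infinite (range (\<lambda>n. X n \<omega>) \<inter> {y<..<y + L})"
    \<comment> \<open>Index \<open>0\<close> is left out because \<open>X m \<omega>\<close> may
      equal the endpoint \<open>y\<close>.\<close>
    moreover have "(\<lambda>i. X (m + i) \<omega>) ` {1..k} \<subseteq> range (\<lambda>n. X n \<omega>) \<inter> {y<..<y + L}"
    proof (rule image_subsetI)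
      fix i assume i: "i \<in> {1..k}"
      then have "X m \<omega> < X (m + i) \<omega>" using incr[of 0 i] kK by simp
      then have "X (m + i) \<omega> \<in> {y<..<y + L}" using below[of i] i Xm by simp
      then show "X (m + i) \<omega> \<in> range (\<lambda>n. X n \<omega>) \<inter> {y<..<y + L}" by simp
    qed
    ultimately have "card ((\<lambda>i. X (m + i) \<omega>) ` {1..k}) \<le> card (range (\<lambda>n. X n \<omega>) \<inter> {y<..<y + L})"
      by (intro card_mono) auto
    moreover have "inj_on (\<lambda>i. X (m + i) \<omega>) {1..k}"
    proof (rule linorder_inj_onI)
      show "X (m + i) \<omega> \<noteq> X (m + j) \<omega>" if "i < j" "i \<in> {1..k}" "j \<in> {1..k}" for i j
        using incr[of i j] that kK by auto
    qed auto
    ultimately show "card (range (\<lambda>n. X n \<omega>) \<inter> {y<..<y + L}) \<ge> k" by (simp add: card_image)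
  qed
  moreover have "strong_cutpoint (\<lambda>n. X n \<omega>) (X r \<omega>)" if r: "X r \<omega> \<in> {y<..<y + L}" for r
  proof -
    have "r \<ge> m" using before[of r] r by (cases "r \<ge> m") auto
    moreover have "r < m + K" using m(3)[of r] r by (cases "r < m + K") auto
    ultimately have i: "r = m + (r - m)" "r - m < K" by auto
    define i where "i = r - m"
    note i = i[folded i_def]
    have "X l \<omega> < X r \<omega>" if "l < r" for l
    proof (cases "l < m")
      case True
      then show ?thesis using before[of l] r by auto
    next
      case False
      then have "l = m + (l - m)" "l - m < i" "i \<le> K" using that i by auto
      then show ?thesis using incr[of "l - m" i] i by simp
    qed
    moreover have "X l \<omega> > X r \<omega>" if "l > r" for l
    proof (cases "l \<ge> m + K")
      case True
      then show ?thesis using m(3)[of l] r by auto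
    next
      case False
      have "l = m + (l - m)" "i < l - m" "l - m \<le> K" using that i False by auto
      then show ?thesis using incr[of i "l - m"] i by simp
    qed
    ultimately show ?thesis using r y by (auto simp: strong_cutpoint_def)
  qed
  ultimately show ?thesis
    using L0 L(2) y by (auto simp: cut_interval_def interior_open is_interval_oo ennreal_leI)
qed

lemma cut_intervals_at_levels:
  assumes L: "L \<ge> (real k + 2) * B" "L \<ge> h"
  obtains G c j\<^sub>1 where "\<And>j. G j \<in> sets M" "c > 0" "AE \<omega> in M. infinite {j. \<omega> \<in> G j}"
    "AE \<omega> in M. \<forall>j. \<omega> \<in> G j \<longrightarrow> cut_interval h k (\<lambda>n. X n \<omega>) (level L j)"
    "\<And>j. j \<ge> j\<^sub>1 \<Longrightarrow> prob (G j) \<ge> c / real j"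
proof -
  have "2 * B \<le> (real k + 2) * B" using B_ge by (intro mult_right_mono) auto
  also note L(1)
  finally have L2: "L \<ge> 2 * B" .
  then have L0: "L \<ge> 0" using B_ge by linarith
  obtain \<delta> K c j\<^sub>1 where \<delta>: "\<delta> > 0" and c: "c > 0" and
    io: "AE \<omega> in M. infinite {j. \<omega> \<in> cut_event L \<delta> K (real j * L)}" and
    low: "\<And>j. j \<ge> j\<^sub>1 \<Longrightarrow> prob (cut_event L \<delta> K (real j * L)) \<ge> c / real j"
    by (rule cut_events_io[OF L2]) blast
  have ci: "AE \<omega> in M. \<forall>j. \<omega> \<in> cut_event L \<delta> K (real j * L) \<longrightarrow> cut_interval h k (\<lambda>n. X n \<omega>) (level L j)"
    using jumps
  proof eventually_elim
    case (elim \<omega>)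
    then show ?case unfolding level_def
      using cut_interval_of_cut_event[OF _ _ \<delta> _ L] L0 by simp
  qed
  show thesis
    by (rule that[of "\<lambda>j. cut_event L \<delta> K (real j * L)", OF cut_event_sets c io ci]) (rule low)
qed

lemma inj_on_level: "L > 0 \<Longrightarrow> inj_on (level L) J"
proof (rule inj_onI, rule ccontr)
  fix i j assume L: "L > 0" and ij: "level L i = level L j" "i \<noteq> j"
  have "real i * L + L / 2 \<in> level L i" using L by (simp add: level_def)
  then show False using disjoint_levels[OF L ij(2)] ij(1) by blast
qed

lemma infinitely_many_cut_intervals:
  "AE \<omega> in M. \<exists>\<I>. infinite \<I> \<and> pairwise disjnt \<I> \<and> (\<forall>I\<in>\<I>. cut_interval h k (\<lambda>n. X n \<omega>) I)"
proof -
  define L where "L = max ((real k + 2) * B) h"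
  have L: "L \<ge> (real k + 2) * B" "L \<ge> h" by (auto simp: L_def)
  have "(real k + 2) * B > 0" using B_ge by (intro mult_pos_pos) auto
  then have L0: "L > 0" using L by linarith
  obtain G where "AE \<omega> in M. infinite {j::nat. \<omega> \<in> G j}"
    "AE \<omega> in M. \<forall>j. \<omega> \<in> G j \<longrightarrow> cut_interval h k (\<lambda>n. X n \<omega>) (level L j)"
    by (rule cut_intervals_at_levels[OF L]) blast
  then show ?thesis
  proof eventually_elim
    case (elim \<omega>)
    have "infinite (level L ` {j. \<omega> \<in> G j})"
      using elim(1) inj_on_level[OF L0] by (simp add: finite_image_iff)
    moreover have "pairwise disjnt (level L ` {j. \<omega> \<in> G j})"
    proof (rule pairwise_imageI)
      show "disjnt (level L i) (level L j)" if "i \<noteq> j" for i j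
        using disjoint_levels[OF L0 that] by (simp add: disjnt_def)
    qed
    ultimately show ?case using elim(2) by blast
  qed
qed

lemma infinite_strong_cutpoints_AE: "AE \<omega> in M. infinite (strong_cutpoints (\<lambda>n. X n \<omega>))"
proof -
  have L: "3 * B \<ge> (real 1 + 2) * B" "3 * B \<ge> B" using B_ge by auto
  have L0: "3 * B > 0" using B_ge by simp
  obtain G where "AE \<omega> in M. infinite {j::nat. \<omega> \<in> G j}"
    "AE \<omega> in M. \<forall>j. \<omega> \<in> G j \<longrightarrow> cut_interval B 1 (\<lambda>n. X n \<omega>) (level (3 * B) j)"
    by (rule cut_intervals_at_levels[OF L]) blast
  then show ?thesis
  proof eventually_elim
    case (elim \<omega>)
    let ?C = "strong_cutpoints (\<lambda>n. X n \<omega>)"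
    obtain f where f: "inj_on f {j. \<omega> \<in> G j}"
      "\<And>j. j \<in> {j. \<omega> \<in> G j} \<Longrightarrow> f j \<in> level (3 * B) j \<inter> ?C"
      by (rule strong_cutpoints_at_levels[OF L0 order_refl, of "{j. \<omega> \<in> G j}" B]) (use elim(2) in auto)
    then have "infinite (f ` {j. \<omega> \<in> G j})" using f(1) elim(1) by (simp add: finite_image_iff)
    then show ?case by (rule infinite_super[rotated]) (use f in auto)
  qed
qed

lemma prob_infinite_strong_cutpoints: "\<P>(\<omega> in M. infinite (strong_cutpoints (\<lambda>n. X n \<omega>))) = 1"
proof -
  have "{\<omega> \<in> space M. infinite (strong_cutpoints (\<lambda>n. X n \<omega>))}
      = {\<omega> \<in> space M. infinite {n. (\<forall>m<n. X m \<omega> < X n \<omega>) \<and> (\<forall>m>n. X m \<omega> > X n \<omega>)}}"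
    by (intro Collect_cong conj_cong refl infinite_strong_cutpoints_iff X_nonneg)
  also have "\<dots> \<in> sets M"
    unfolding infinite_nat_iff_unbounded_le mem_Collect_eq by measurable
  finally have [measurable]: "{\<omega> \<in> space M. infinite (strong_cutpoints (\<lambda>n. X n \<omega>))} \<in> sets M" .
  show ?thesis
    by (subst prob_Collect_eq_1) (use infinite_strong_cutpoints_AE in auto)
qed

text \<open>Every level event that occurs below \<open>x\<close> contributes its own strong
  cutpoint, so the expectation is at least the sum of the probabilities, a tail of the harmonic
  sum.\<close>

lemma expected_strong_cutpoints_lower:
  "\<exists>c>0. \<forall>\<^sub>F x in at_top. ennreal (c * ln x) \<le>
    (\<integral>\<^sup>+ \<omega>. emeasure (count_space UNIV) (strong_cutpoints (\<lambda>n. X n \<omega>) \<inter> {0..x}) \<partial>M)"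
proof -
  define L where "L = 3 * B"
  have L: "L \<ge> (real 1 + 2) * B" "L \<ge> B" and L0: "L > 0" using B_ge by (auto simp: L_def)
  obtain G c j\<^sub>1 where G [measurable]: "\<And>j::nat. G j \<in> sets M" and c: "c > 0" and
    ci: "AE \<omega> in M. \<forall>j. \<omega> \<in> G j \<longrightarrow> cut_interval B 1 (\<lambda>n. X n \<omega>) (level L j)" and
    low: "\<And>j. j \<ge> j\<^sub>1 \<Longrightarrow> prob (G j) \<ge> c / real j"
    by (rule cut_intervals_at_levels[OF L]) blast
  define I where "I m = {max 1 j\<^sub>1..m}" for m
  have count: "AE \<omega> in M. (\<Sum>j\<in>I m. indicator (G j) \<omega>)
      \<le> emeasure (count_space UNIV) (strong_cutpoints (\<lambda>n. X n \<omega>) \<inter> {0..x})"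
    if m: "(real m + 1) * L \<le> x" for m x
    using ci
  proof eventually_elim
    case (elim \<omega>)
    let ?C = "strong_cutpoints (\<lambda>n. X n \<omega>)"
    let ?J = "{j \<in> I m. \<omega> \<in> G j}"
    obtain f where inj: "inj_on f ?J" and f: "\<And>j. j \<in> ?J \<Longrightarrow> f j \<in> level L j \<inter> ?C"
      by (rule strong_cutpoints_at_levels[OF L0 order_refl, of ?J B]) (use elim in auto)
    have sub: "f ` ?J \<subseteq> ?C \<inter> {0..x}"
    proof safe
      fix j assume j: "j \<in> I m" "\<omega> \<in> G j"
      have fj: "real j * L < f j" "f j < real j * L + L" using f[of j] j by (auto simp: level_def)
      have "(real j + 1) * L \<le> (real m + 1) * L"
        using j(1) L0 by (intro mult_right_mono) (auto simp: I_def)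
      moreover have "real j * L \<ge> 0" "real j * L + L = (real j + 1) * L"
        using L0 by (simp_all add: distrib_right)
      ultimately have "0 \<le> f j" "f j \<le> x" using fj m by linarith+
      then show "f j \<in> {0..x}" by simp
    qed (use f in auto)
    have "(\<Sum>j\<in>I m. indicator (G j) \<omega> :: ennreal) = of_nat (card ?J)"
      by (simp add: indicator_def sum.If_cases I_def Int_def)
    also have "\<dots> = emeasure (count_space UNIV) (f ` ?J)"
      using inj by (subst emeasure_count_space_finite) (auto simp: card_image I_def)
    also have "\<dots> \<le> emeasure (count_space UNIV) (?C \<inter> {0..x})"
      using sub by (intro emeasure_mono) auto
    finally show ?case .
  qed
  \<comment> \<open>The head of the harmonic sum, over the levels where the lower bound is not yet
    available.\<close>
  define H where "H = (harm (max 1 j\<^sub>1 - 1) :: real)"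
  have bound: "ennreal (c * (ln (real m + 1) - H)) \<le>
      (\<integral>\<^sup>+ \<omega>. emeasure (count_space UNIV) (strong_cutpoints (\<lambda>n. X n \<omega>) \<inter> {0..x}) \<partial>M)"
    if m: "(real m + 1) * L \<le> x" for m x
  proof -
    have "ln (real m + 1) \<le> harm m" by (rule ln_le_harm)
    also have "harm m \<le> (\<Sum>j\<in>{1..max 1 j\<^sub>1 - 1} \<union> I m. inverse (real j))"
      unfolding harm_def by (intro sum_mono2) (auto simp: I_def)
    also have "\<dots> = H + (\<Sum>j\<in>I m. inverse (real j))"
      unfolding H_def harm_def by (intro sum.union_disjoint) (auto simp: I_def)
    finally have "c * (ln (real m + 1) - H) \<le> c * (\<Sum>j\<in>I m. inverse (real j))"
      using c by (intro mult_left_mono) auto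
    also have "\<dots> = (\<Sum>j\<in>I m. c / real j)" by (simp add: sum_distrib_left divide_inverse)
    also have "\<dots> \<le> (\<Sum>j\<in>I m. prob (G j))" by (intro sum_mono low) (auto simp: I_def)
    finally have "ennreal (c * (ln (real m + 1) - H)) \<le> ennreal (\<Sum>j\<in>I m. prob (G j))"
      by (rule ennreal_leI)
    also have "\<dots> = (\<Sum>j\<in>I m. emeasure M (G j))"
      by (simp add: emeasure_eq_measure sum_ennreal)
    also have "\<dots> = (\<integral>\<^sup>+ \<omega>. (\<Sum>j\<in>I m. indicator (G j) \<omega>) \<partial>M)"
      by (subst nn_integral_sum) auto
    also have "\<dots> \<le> (\<integral>\<^sup>+ \<omega>. emeasure (count_space UNIV) (strong_cutpoints (\<lambda>n. X n \<omega>) \<inter> {0..x}) \<partial>M)"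
      \<comment> \<open>Monotonicity asks for no measurability, so the cutpoint count is never shown
        to be measurable.\<close>
      by (rule nn_integral_mono_AE[OF count[OF m]])
    finally show ?thesis .
  qed
  \<comment> \<open>Halving the constant absorbs \<open>ln (2 * L) + H\<close>; this is where the
    exponential threshold comes from.\<close>
  have "\<forall>\<^sub>F x in at_top. ennreal (c / 2 * ln x) \<le>
    (\<integral>\<^sup>+ \<omega>. emeasure (count_space UNIV) (strong_cutpoints (\<lambda>n. X n \<omega>) \<inter> {0..x}) \<partial>M)"
    using eventually_ge_at_top[of "2 * L"] eventually_ge_at_top[of "exp (2 * (ln (2 * L) + H))"]
  proof eventually_elim
    case (elim x)
    have x0: "x > 0" using elim(1) L0 by simp
    \<comment> \<open>The last level that fits below \<open>x\<close>: level \<open>m\<close> ends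
      at \<open>(real m + 1) * L\<close>.\<close>
    define m where "m = nat (\<lfloor>x / L\<rfloor> - 1)"
    have "x / L \<ge> 2" using elim(1) L0 by (simp add: field_simps)
    then have "\<lfloor>x / L\<rfloor> \<ge> 2" by (simp add: le_floor_iff)
    then have m: "real m + 1 = of_int \<lfloor>x / L\<rfloor>" unfolding m_def by (subst of_nat_nat) auto
    have "(real m + 1) * L \<le> x / L * L" unfolding m using L0 by (intro mult_right_mono) auto
    then have mL: "(real m + 1) * L \<le> x" using L0 by simp
    have "x / (2 * L) \<le> real m + 1"
    proof -
      have "x / L - 1 \<le> real m + 1" unfolding m by linarith
      moreover have "x / (2 * L) = x / L / 2" by simp
      ultimately show ?thesis using \<open>x / L \<ge> 2\<close> by linarith
    qed
    then have "ln (x / (2 * L)) \<le> ln (real m + 1)" using x0 L0 by (intro ln_mono) auto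
    then have 1: "ln x - ln (2 * L) \<le> ln (real m + 1)" using x0 L0 by (simp add: ln_div)
    have "2 * (ln (2 * L) + H) \<le> ln x" using elim(2) x0 by (simp add: ln_ge_iff)
    then have "c * (ln x / 2) \<le> c * (ln (real m + 1) - H)"
      using 1 c by (intro mult_left_mono) auto
    then have "ennreal (c / 2 * ln x) \<le> ennreal (c * (ln (real m + 1) - H))"
      by (intro ennreal_leI) simp
    also note bound[OF mL]
    finally show ?case .
  qed
  then show ?thesis using c by (intro exI[of _ "c / 2"]) auto
qed

end

section \<open>From limits along the state space to bounds beyond a threshold\<close>

lemma eventually_at_top_along:
  "eventually P (at_top_along S) \<longleftrightarrow> (\<exists>N. \<forall>x\<in>S. x \<ge> N \<longrightarrow> P x)"
  by (auto simp: at_top_along_def eventually_inf_principal eventually_at_top_linorder)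

text \<open>The lower limit may be infinite, so a real number strictly between it and
  \<open>0\<close> is taken as the bound.\<close>

lemma Liminf_along_posD:
  assumes "Liminf (at_top_along S) (\<lambda>x. ereal (f x)) > 0"
  shows "\<exists>c N. c > 0 \<and> (\<forall>x\<in>S. x \<ge> N \<longrightarrow> f x > c)"
proof -
  obtain c where c: "0 < ereal c" "ereal c < Liminf (at_top_along S) (\<lambda>x. ereal (f x))"
    using ereal_dense2[OF assms] by blast
  have "eventually (\<lambda>x. ereal c < ereal (f x)) (at_top_along S)"
    using c(2) by (rule less_LiminfD)
  then show ?thesis using c(1) unfolding eventually_at_top_along by auto
qed

lemma Limsup_along_finiteD:
  assumes "Limsup (at_top_along S) (\<lambda>x. ereal (f x)) < \<infinity>"
  shows "\<exists>c N. \<forall>x\<in>S. x \<ge> N \<longrightarrow> f x < c"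
proof -
  obtain c where c: "Limsup (at_top_along S) (\<lambda>x. ereal (f x)) < ereal c"
    using ereal_dense2[OF assms] by blast
  then have "eventually (\<lambda>x. ereal (f x) < ereal c) (at_top_along S)"
    by (rule Limsup_lessD)
  then show ?thesis unfolding eventually_at_top_along by auto
qed

theorem theorem1p2:
  fixes M :: "'a measure"
    and F :: "nat \<Rightarrow> 'a measure"
    and X :: "nat \<Rightarrow> 'a \<Rightarrow> real"
    and S :: "real set"
    and mu_lo mu_up :: "nat \<Rightarrow> real \<Rightarrow> real"
  assumes "prob_space M"
    and "filtration (space M) F"
    and "\<And>n. subalgebra M (F n)"
    and "S \<in> sets borel" and "S \<subseteq> {0..}"
    and "(INF x\<in>S. ereal x) = 0" and "(SUP x\<in>S. ereal x) = \<infinity>"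
    and adapted: "\<And>n. X n \<in> borel_measurable (F n)"
    and "\<And>n \<omega>. \<omega> \<in> space M \<Longrightarrow> X n \<omega> \<in> S"
    and "\<And>k. k \<in> {1, 2} \<Longrightarrow> mu_lo k \<in> borel_measurable (restrict_space borel S)"
    and "\<And>k. k \<in> {1, 2} \<Longrightarrow> mu_up k \<in> borel_measurable (restrict_space borel S)"
    and "\<And>n k. k \<in> {1, 2} \<Longrightarrow>
           AE \<omega> in M.
             mu_lo k (X n \<omega>) \<le> real_cond_exp M (F n) (\<lambda>\<omega>. (X (Suc n) \<omega> - X n \<omega>) ^ k) \<omega> \<and>
             real_cond_exp M (F n) (\<lambda>\<omega>. (X (Suc n) \<omega> - X n \<omega>) ^ k) \<omega> \<le> mu_up k (X n \<omega>)"
    and B: "\<exists>B::real. \<forall>n. \<P>(\<omega> in M. \<bar>X (Suc n) \<omega> - X n \<omega>\<bar> \<le> B) = 1"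
    and N: "AE \<omega> in M. limsup (\<lambda>n. ereal (X n \<omega>)) = \<infinity>"
    and V: "Liminf (at_top_along S) (\<lambda>x. ereal (mu_lo 2 x)) > 0"
    and "Liminf (at_top_along S) (\<lambda>x. ereal (2 * x * mu_lo 1 x - mu_up 2 x)) > 0"
    and "Limsup (at_top_along S) (\<lambda>x. ereal (x * mu_up 1 x)) < \<infinity>"
  shows "(\<forall>h>0. \<forall>k. AE \<omega> in M.
            \<exists>\<I>. infinite \<I> \<and> pairwise disjnt \<I> \<and>
                 (\<forall>I\<in>\<I>. cut_interval h k (\<lambda>n. X n \<omega>) I))
       \<and> \<P>(\<omega> in M. infinite (strong_cutpoints (\<lambda>n. X n \<omega>))) = 1
       \<and> (integrable M (X 0) \<longrightarrow>
            (\<exists>c>0. \<forall>\<^sub>F x in at_top.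
               ennreal (c * ln x) \<le>
                 (\<integral>\<^sup>+ \<omega>. emeasure (count_space UNIV)
                    (strong_cutpoints (\<lambda>n. X n \<omega>) \<inter> {0..x}) \<partial>M)))"
proof -
  interpret prob_space M by fact
  have F_mono: "\<And>m n. m \<le> n \<Longrightarrow> sets (F m) \<subseteq> sets (F n)"
    using assms(2) by (auto simp: filtration_def)
  obtain B\<^sub>0 where B\<^sub>0: "\<And>n. \<P>(\<omega> in M. \<bar>X (Suc n) \<omega> - X n \<omega>\<bar> \<le> B\<^sub>0) = 1" using B by blast
  \<comment> \<open>The locale is normalised to a jump bound of at least \<open>1\<close>.\<close>
  define B' where "B' = max 1 B\<^sub>0"
  have X_meas [measurable]: "X n \<in> borel_measurable M" for n
    using measurable_from_subalg[OF assms(3) adapted] .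
  obtain v N\<^sub>1 where v: "v > 0" "\<And>x. x \<in> S \<Longrightarrow> x \<ge> N\<^sub>1 \<Longrightarrow> mu_lo 2 x > v"
    using Liminf_along_posD[OF V] by blast
  obtain \<epsilon> N\<^sub>2 where \<epsilon>: "\<epsilon> > 0" "\<And>x. x \<in> S \<Longrightarrow> x \<ge> N\<^sub>2 \<Longrightarrow> 2 * x * mu_lo 1 x - mu_up 2 x > \<epsilon>"
    using Liminf_along_posD[OF assms(16)] by blast
  obtain c\<^sub>1 N\<^sub>3 where c1: "\<And>x. x \<in> S \<Longrightarrow> x \<ge> N\<^sub>3 \<Longrightarrow> x * mu_up 1 x < c\<^sub>1"
    using Limsup_along_finiteD[OF assms(17)] by blast
  define x\<^sub>0 where "x\<^sub>0 = max (max N\<^sub>1 N\<^sub>2) N\<^sub>3"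
  have jump: "AE \<omega> in M. \<bar>X (Suc n) \<omega> - X n \<omega>\<bar> \<le> B\<^sub>0" for n
    using B\<^sub>0[of n] by (subst (asm) prob_Collect_eq_1) auto
  interpret drift_process M F X x\<^sub>0 B' \<epsilon> v c\<^sub>1
  proof
    show "subalgebra M (F n)" for n by fact
    show "sets (F m) \<subseteq> sets (F n)" if "m \<le> n" for m n using that by (rule F_mono)
    show "X n \<in> borel_measurable (F n)" for n by fact
    show "0 \<le> X n \<omega>" if "\<omega> \<in> space M" for n \<omega> using assms(5) assms(9)[OF that, of n] by auto
    show "1 \<le> B'" by (simp add: B'_def)
    show "0 < \<epsilon>" "0 < v" by fact+
    have "AE \<omega> in M. \<forall>n. \<bar>X (Suc n) \<omega> - X n \<omega>\<bar> \<le> B\<^sub>0" using jump by (simp add: AE_all_countable)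
    then show "AE \<omega> in M. \<forall>n. \<bar>X (Suc n) \<omega> - X n \<omega>\<bar> \<le> B'"
      by eventually_elim (simp add: B'_def le_max_iff_disj)
    show "AE \<omega> in M. \<forall>y. \<exists>n. y < X n \<omega>"
      using N
    proof eventually_elim
      case (elim \<omega>)
      show ?case
      proof (rule ccontr)
        assume "\<not> ?thesis"
        then obtain y where "\<And>n. X n \<omega> \<le> y" by (auto simp: not_less)
        then have "limsup (\<lambda>n. ereal (X n \<omega>)) \<le> ereal y" by (intro Limsup_bounded) auto
        then show False using elim by simp
      qed
    qed
    show "AE \<omega> in M. x\<^sub>0 \<le> X n \<omega> \<longrightarrow>
      \<epsilon> \<le> 2 * X n \<omega> * real_cond_exp M (F n) (\<lambda>\<omega>. X (Suc n) \<omega> - X n \<omega>) \<omega>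
            - real_cond_exp M (F n) (\<lambda>\<omega>. (X (Suc n) \<omega> - X n \<omega>)\<^sup>2) \<omega> \<and>
      v \<le> real_cond_exp M (F n) (\<lambda>\<omega>. (X (Suc n) \<omega> - X n \<omega>)\<^sup>2) \<omega> \<and>
      X n \<omega> * real_cond_exp M (F n) (\<lambda>\<omega>. X (Suc n) \<omega> - X n \<omega>) \<omega> \<le> c\<^sub>1" for n
    proof -
      have "AE \<omega> in M. mu_lo 1 (X n \<omega>) \<le> real_cond_exp M (F n) (\<lambda>\<omega>. X (Suc n) \<omega> - X n \<omega>) \<omega> \<and>
          real_cond_exp M (F n) (\<lambda>\<omega>. X (Suc n) \<omega> - X n \<omega>) \<omega> \<le> mu_up 1 (X n \<omega>)"
        using assms(12)[of 1 n] by simp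
      moreover have "AE \<omega> in M. mu_lo 2 (X n \<omega>) \<le> real_cond_exp M (F n) (\<lambda>\<omega>. (X (Suc n) \<omega> - X n \<omega>)\<^sup>2) \<omega> \<and>
          real_cond_exp M (F n) (\<lambda>\<omega>. (X (Suc n) \<omega> - X n \<omega>)\<^sup>2) \<omega> \<le> mu_up 2 (X n \<omega>)"
        using assms(12)[of 2 n] by simp
      ultimately show ?thesis
        using AE_space
      proof eventually_elim
        case (elim \<omega>)
        let ?x = "X n \<omega>"
        let ?d = "real_cond_exp M (F n) (\<lambda>\<omega>. X (Suc n) \<omega> - X n \<omega>) \<omega>"
        show ?case
        proof
          assume x: "x\<^sub>0 \<le> ?x"
          have S: "?x \<in> S" "?x \<ge> 0" using assms(5) assms(9)[OF elim(3), of n] by auto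
          \<comment> \<open>As the state is nonnegative, multiplying by it preserves the bounds on
            the first conditional moment, which turns the hypotheses on the bounding functions into
            bounds on the moments.\<close>
          have "2 * ?x * mu_lo 1 ?x \<le> 2 * ?x * ?d" "?x * ?d \<le> ?x * mu_up 1 ?x"
            using elim(1) S(2) by (auto intro!: mult_left_mono)
          then show "\<epsilon> \<le> 2 * ?x * ?d - real_cond_exp M (F n) (\<lambda>\<omega>. (X (Suc n) \<omega> - X n \<omega>)\<^sup>2) \<omega> \<and>
              v \<le> real_cond_exp M (F n) (\<lambda>\<omega>. (X (Suc n) \<omega> - X n \<omega>)\<^sup>2) \<omega> \<and> ?x * ?d \<le> c\<^sub>1"
            using elim(2) v(2)[OF S(1)] \<epsilon>(2)[OF S(1)] c1[OF S(1)] x by (auto simp: x\<^sub>0_def)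
        qed
      qed
    qed
  qed
  show ?thesis
    using infinitely_many_cut_intervals prob_infinite_strong_cutpoints expected_strong_cutpoints_lower by blast
qed

end
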